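(* Let $\rho$ be a unitary representation of the tri-symmetric group $\mathbb G=\mathbb G^{[3]}$ in a Hilbert space $H$. For all $\alpha,\beta,\gamma\in\mathbb Z_{\ge 0}$ and all double cosets $\mathfrak a\in K(\alpha)\backslash\mathbb G/K(\beta)$, $\mathfrak b\in K(\beta)\backslash\mathbb G/K(\gamma)$ one has $$\overline\rho(\mathfrak a)\,\overline\rho(\mathfrak b)=\overline\rho(\mathfrak a\circ\mathfrak b).$$
   Context: Group. $S_\infty$ is the group of all permutations of $\mathbb N=\{1,2,\dots\}$; $S_\infty(\alpha)$ is the pointwise stabilizer of $1,\dots,\alpha$ ($S_\infty(0)=S_\infty$); $S_\infty^{fin}$ is the subgroup of finitely supported permutations. $\mathbb G=\mathbb G^{[3]}$ is the group of triples $(g_{red},g_{yellow},g_{blue})\in S_\infty^3$ such that $g_ig_j^{-1}\in S_\infty^{fin}$ for all $i,j$. $K\subset\mathbb G$ is the diagonal copy of $S_\infty$ and $K(\alpha)\subset K$ the diagonal copy of $S_\infty(\alpha)$. The topology on $\mathbb G$ is the group topology in which the subgroups $K(\alpha)$ are open and form a base of neighborhoods of the identity. Unitary representations are assumed continuous (strong = weak operator topology). Operators. $H(\alpha)\subset H$ is the space of $K(\alpha)$-fixed vectors, $P(\alpha)$ the orthogonal projection onto $H(\alpha)$. For $\mathbf p\in\mathbb G$ put $\overline\rho(\mathbf p):=P(\alpha)\rho(\mathbf p)|_{H(\beta)}:H(\beta)\to H(\alpha)$. It depends only on the double coset $\mathfrak a=K(\alpha)\mathbf pK(\beta)$ and is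 denoted $\overline\rho(\mathfrak a)$. Boards. An $(\alpha,\beta)$-board is a compact closed oriented (possibly disconnected or empty) triangulated surface, up to isomorphism, whose triangles are colored black and white so that neighbors have opposite colors, whose edges are colored red, yellow, blue so that each black (white) triangle has one edge of each color, in the cyclic order red, yellow, blue anticlockwise (clockwise), together with labels $1,\dots,\beta$ assigned to distinct black triangles and $1,\dots,\alpha$ assigned to distinct white triangles (other triangles are unlabeled), such that no component is an empty cheburek. A cheburek is a component consisting of one black and one white triangle glued along all three edges of the same colors; it is empty if neither triangle is labeled. Equivalently, a board consists of finite sets of black and white triangles and, for each color, a bijection from black to white triangles (adjacency along the edge of that color), plus labels. Double cosets as boards. To $\mathbf g\in\mathbb G$ associate black triangles $A_i$ and white triangles $B_i$, $i\in\mathbb N$, and for each color $c$ glue the $c$-edge of $A_i$ to the $c$-edge of $B_{g_c(i)}$; then forget the numbers $>\beta$ on black and $>\alpha$ on white triangles and delete all empty chebureks. This gives a bijection between $K(\alpha)\backslash\mathbb G/K(\beta)$ and the set of $(\alpha,\beta)$-boards, and the two sets are identified. Multiplication. For an $(\alpha,\beta)$-board $\mathfrak a$ and a $(\beta,\gamma)$-board $\mathfrak b$, the $(\alpha,\gamma)$-board $\mathfrak a\circ\mathfrak b$ is obtained as follows: for each $j=1,\dots,\beta$ cut out the black triangle of $\mathfrak a$ with label $j$ and the white triangle of $\mathfrak b$ with label $j$, and glue the perimeters of the two holes according to colors and orientations of edges; keep the remaining labels ($1,\dots,\alpha$ on white triangles coming from $\mathfrak a$, $1,\dots,\gamma$ on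 black triangles coming from $\mathfrak b$) and discard empty chebureks. *)

theory Defs
  imports
    "HOL-Analysis.Analysis"
    "HOL-Algebra.Coset"
    "HOL-Combinatorics.Permutations"
begin

section \<open>Complex Hilbert spaces and unitary operators\<close>

text \<open>
  A complex Hilbert space is a complete real inner product space with a complex structure, where
  the real inner product is the real part of the complex one. The axiom linking the two inner
  products makes the norm of \<open>x\<close> equal to the square root of \<open>cinner x x\<close>.
\<close>

class complex_hilbert = real_inner + complete_space +
  fixes scaleC :: "complex \<Rightarrow> 'a \<Rightarrow> 'a"
    and cinner :: "'a \<Rightarrow> 'a \<Rightarrow> complex"
  assumes scaleC_add_right: "scaleC a (x + y) = scaleC a x + scaleC a y"
    and scaleC_add_left: "scaleC (a + b) x = scaleC a x + scaleC b x"
    and scaleC_scaleC: "scaleC a (scaleC b x) = scaleC (a * b) x"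
    and scaleR_scaleC: "r *\<^sub>R x = scaleC (complex_of_real r) x"
    and cinner_commute: "cinner x y = cnj (cinner y x)"
    and cinner_add_left: "cinner (x + y) z = cinner x z + cinner y z"
    and cinner_scaleC_left: "cinner (scaleC a x) y = a * cinner x y"
    and inner_eq_Re_cinner: "x \<bullet> y = Re (cinner x y)"

lemma vector_space_scaleC: "vector_space (scaleC :: complex \<Rightarrow> 'h::complex_hilbert \<Rightarrow> 'h)"
proof
  show "scaleC 1 x = x" for x :: 'h
    using scaleR_scaleC[of 1 x] by simp
qed (auto simp: scaleC_add_right scaleC_add_left scaleC_scaleC)

instantiation complex :: complex_hilbert
begin
definition scaleC_complex :: "complex \<Rightarrow> complex \<Rightarrow> complex" where "scaleC_complex a x = a * x"
definition cinner_complex :: "complex \<Rightarrow> complex \<Rightarrow> complex" where "cinner_complex x y = x * cnj y"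
instance
  by standard
    (auto simp: scaleC_complex_def cinner_complex_def algebra_simps inner_complex_def
      scaleR_conv_of_real)
end

definition unitary_group :: "('h::complex_hilbert \<Rightarrow> 'h) monoid" where
  "unitary_group =
    \<lparr>carrier = {U. Vector_Spaces.linear scaleC scaleC U \<and> surj U \<and>
                  (\<forall>x y. cinner (U x) (U y) = cinner x y)},
     monoid.mult = (\<circ>), one = id\<rparr>"

text \<open>The orthogonal projection onto a closed subspace.\<close>

definition orth_proj :: "'h::complex_hilbert set \<Rightarrow> 'h \<Rightarrow> 'h" where
  "orth_proj M x = (THE y. y \<in> M \<and> (\<forall>z\<in>M. cinner (x - y) z = 0))"


section \<open>The tri-symmetric group\<close>

datatype color = Red | Yellow | Blue

text \<open>
  Permutations of \<open>{1,2,\<dots>}\<close> are functions on \<^typ>\<open>nat\<close> that fix the extra point \<open>0\<close>.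
\<close>

definition S_inf :: "nat \<Rightarrow> (nat \<Rightarrow> nat) set" where
  "S_inf \<alpha> = {s. s permutes {1..} \<and> (\<forall>i\<in>{1..\<alpha>}. s i = i)}"

definition S_fin :: "(nat \<Rightarrow> nat) set" where
  "S_fin = {s \<in> S_inf 0. finite {i. s i \<noteq> i}}"

type_synonym triple = "color \<Rightarrow> nat \<Rightarrow> nat"

definition trisym :: "triple monoid" where
  "trisym =
    \<lparr>carrier = {g. (\<forall>c. g c \<in> S_inf 0) \<and> (\<forall>c d. g c \<circ> inv_into UNIV (g d) \<in> S_fin)},
     monoid.mult = (\<lambda>g h c. g c \<circ> h c), one = (\<lambda>c. id)\<rparr>"

definition K :: "nat \<Rightarrow> triple set" where
  "K \<alpha> = {(\<lambda>c. s) | s. s \<in> S_inf \<alpha>}"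

lemma carrier_trisym_iff:
  "g \<in> carrier trisym \<longleftrightarrow>
     (\<forall>c. g c permutes {1..}) \<and> (\<forall>c d. finite {i. g c i \<noteq> g d i})"
proof -
  have "g c \<circ> inv_into UNIV (g d) \<in> S_fin \<longleftrightarrow> finite {i. g c i \<noteq> g d i}"
    if g: "\<forall>c. g c permutes {1..}" for c d
  proof -
    have "g c \<circ> inv_into UNIV (g d) permutes {1..}"
      using g by (intro permutes_compose permutes_inv) auto
    moreover have "{j. (g c \<circ> inv_into UNIV (g d)) j \<noteq> j} = g d ` {i. g c i \<noteq> g d i}"
    proof (intro equalityI subsetI)
      fix j assume j: "j \<in> {j. (g c \<circ> inv_into UNIV (g d)) j \<noteq> j}"
      have "g d (inv_into UNIV (g d) j) = j"
        by (rule permutes_inverses(1)[OF g[rule_format]])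
      with j show "j \<in> g d ` {i. g c i \<noteq> g d i}"
        by (intro image_eqI[of _ _ "inv_into UNIV (g d) j"]) simp_all
    next
      fix j assume "j \<in> g d ` {i. g c i \<noteq> g d i}"
      then obtain i where i: "j = g d i" "g c i \<noteq> g d i" by blast
      moreover have "inv_into UNIV (g d) (g d i) = i"
        by (rule permutes_inverses(2)[OF g[rule_format]])
      ultimately show "j \<in> {j. (g c \<circ> inv_into UNIV (g d)) j \<noteq> j}" by simp
    qed
    moreover have "finite (g d ` {i. g c i \<noteq> g d i}) \<longleftrightarrow> finite {i. g c i \<noteq> g d i}"
      using g permutes_inj_on by (intro finite_image_iff) blast
    ultimately show ?thesis
      by (simp add: S_fin_def S_inf_def)
  qed
  then show ?thesis
    by (auto simp: trisym_def S_inf_def)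
qed

lemma trisym_simps [simp]:
  "g \<otimes>\<^bsub>trisym\<^esub> h = (\<lambda>c. g c \<circ> h c)" "\<one>\<^bsub>trisym\<^esub> = (\<lambda>c. id)"
  by (simp_all add: trisym_def)

lemma group_trisym: "group trisym"
proof (rule groupI)
  fix g h assume g: "g \<in> carrier trisym" and h: "h \<in> carrier trisym"
  have "finite {i. g c (h c i) \<noteq> g d (h d i)}" for c d
  proof (rule finite_subset)
    show "{i. g c (h c i) \<noteq> g d (h d i)} \<subseteq>
        {i. h c i \<noteq> h d i} \<union> h d -` {i. g c i \<noteq> g d i}"
      by auto
    show "finite ({i. h c i \<noteq> h d i} \<union> h d -` {i. g c i \<noteq> g d i})"
    proof (intro finite_UnI finite_vimageI)
      show "finite {i. h c i \<noteq> h d i}" "finite {i. g c i \<noteq> g d i}"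
        using g h unfolding carrier_trisym_iff by blast+
      have "h d permutes {1..}" using h unfolding carrier_trisym_iff by blast
      then show "inj (h d)" by (rule permutes_inj)
    qed
  qed
  moreover have "g c \<circ> h c permutes {1..}" for c
    using g h unfolding carrier_trisym_iff by (intro permutes_compose) blast+
  ultimately show "g \<otimes>\<^bsub>trisym\<^esub> h \<in> carrier trisym"
    by (simp add: carrier_trisym_iff)
next
  fix g assume g: "g \<in> carrier trisym"
  have "finite {i. inv_into UNIV (g c) i \<noteq> inv_into UNIV (g d) i}" for c d
  proof (rule finite_subset)
    show "{i. inv_into UNIV (g c) i \<noteq> inv_into UNIV (g d) i} \<subseteq> g d ` {i. g c i \<noteq> g d i}"
    proof
      fix i assume i: "i \<in> {i. inv_into UNIV (g c) i \<noteq> inv_into UNIV (g d) i}"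
      define j where "j = inv_into UNIV (g d) i"
      have gp: "g c permutes {1..}" "g d permutes {1..}"
        using g by (simp_all add: carrier_trisym_iff)
      have j: "g d j = i"
        by (simp add: j_def permutes_inverses(1)[OF gp(2)])
      moreover have "g c j \<noteq> g d j"
      proof
        assume "g c j = g d j"
        then have "inv_into UNIV (g c) i = j"
          using permutes_inverses(2)[OF gp(1), of j] j by simp
        then show False using i by (simp add: j_def)
      qed
      ultimately
      show "i \<in> g d ` {i. g c i \<noteq> g d i}" by blast
    qed
    show "finite (g d ` {i. g c i \<noteq> g d i})"
      using g unfolding carrier_trisym_iff by blast
  qed
  moreover have gp: "g c permutes {1..}" for c
    using g unfolding carrier_trisym_iff by blast
  ultimately have "(\<lambda>c. inv_into UNIV (g c)) \<in> carrier trisym"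
    using permutes_inv[OF gp] by (simp add: carrier_trisym_iff)
  moreover have "(\<lambda>c. inv_into UNIV (g c)) \<otimes>\<^bsub>trisym\<^esub> g = \<one>\<^bsub>trisym\<^esub>"
    using permutes_inverses(2)[OF gp] by (simp add: fun_eq_iff)
  ultimately show "\<exists>h\<in>carrier trisym. h \<otimes>\<^bsub>trisym\<^esub> g = \<one>\<^bsub>trisym\<^esub>"
    by blast
next
  show "\<one>\<^bsub>trisym\<^esub> \<in> carrier trisym" by (simp add: carrier_trisym_iff)
qed (simp_all add: o_assoc)

lemma S_inf_compose: "s \<in> S_inf \<alpha> \<Longrightarrow> t \<in> S_inf \<alpha> \<Longrightarrow> s \<circ> t \<in> S_inf \<alpha>"
  by (auto simp: S_inf_def intro!: permutes_compose)

lemma S_inf_inv: "s \<in> S_inf \<alpha> \<Longrightarrow> inv_into UNIV s \<in> S_inf \<alpha>"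
  by (auto simp: S_inf_def permutes_inv permutes_inv_eq)

lemma S_inf_id: "id \<in> S_inf \<alpha>"
  by (auto simp: S_inf_def)

lemma K_subset: "K \<alpha> \<subseteq> carrier trisym"
  by (auto simp: K_def carrier_trisym_iff S_inf_def)

lemma subgroup_K: "subgroup (K \<alpha>) trisym"
proof -
  interpret group trisym by (rule group_trisym)
  show ?thesis
  proof (rule subgroupI)
    fix k assume "k \<in> K \<alpha>"
    then obtain s where s: "s \<in> S_inf \<alpha>" and k: "k = (\<lambda>c. s)" by (auto simp: K_def)
    then have "(\<lambda>c. inv_into UNIV s) \<in> K \<alpha>" by (auto simp: K_def S_inf_inv)
    moreover have "inv\<^bsub>trisym\<^esub> k = (\<lambda>c. inv_into UNIV s)"
      using s K_subset \<open>(\<lambda>c. inv_into UNIV s) \<in> K \<alpha>\<close> \<open>k \<in> K \<alpha>\<close>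
      by (intro inv_equality) (auto simp: k S_inf_def permutes_inverses fun_eq_iff)
    ultimately show "inv\<^bsub>trisym\<^esub> k \<in> K \<alpha>" by simp
  next
    show "K \<alpha> \<noteq> {}" using S_inf_id by (auto simp: K_def)
  next
    fix k l assume "k \<in> K \<alpha>" "l \<in> K \<alpha>"
    then show "k \<otimes>\<^bsub>trisym\<^esub> l \<in> K \<alpha>"
      using S_inf_compose by (auto simp: K_def)
  qed (rule K_subset)
qed

lemma S_inf_antimono: "\<alpha> \<le> \<beta> \<Longrightarrow> S_inf \<beta> \<subseteq> S_inf \<alpha>"
  by (auto simp: S_inf_def)

lemma K_antimono: "\<alpha> \<le> \<beta> \<Longrightarrow> K \<beta> \<subseteq> K \<alpha>"
  using S_inf_antimono by (fastforce simp: K_def)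

definition trisym_topology :: "triple topology" where
  "trisym_topology = topology (\<lambda>U. U \<subseteq> carrier trisym \<and>
     (\<forall>g\<in>U. \<exists>\<alpha>. g <#\<^bsub>trisym\<^esub> K \<alpha> \<subseteq> U))"

lemma openin_trisym_topology:
  "openin trisym_topology U \<longleftrightarrow>
     U \<subseteq> carrier trisym \<and> (\<forall>g\<in>U. \<exists>\<alpha>. g <#\<^bsub>trisym\<^esub> K \<alpha> \<subseteq> U)"
proof -
  let ?P = "\<lambda>U. U \<subseteq> carrier trisym \<and> (\<forall>g\<in>U. \<exists>\<alpha>. g <#\<^bsub>trisym\<^esub> K \<alpha> \<subseteq> U)"
  have mono: "g <#\<^bsub>trisym\<^esub> K (max \<alpha> \<beta>) \<subseteq> (g <#\<^bsub>trisym\<^esub> K \<alpha>) \<inter> (g <#\<^bsub>trisym\<^esub> K \<beta>)"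
    for g \<alpha> \<beta>
    using K_antimono[of \<alpha> "max \<alpha> \<beta>"] K_antimono[of \<beta> "max \<alpha> \<beta>"]
    unfolding l_coset_def by auto
  have "istopology ?P"
    unfolding istopology_def
  proof (intro conjI allI impI; (elim conjE)?)
    fix S T assume "\<forall>g\<in>S. \<exists>\<alpha>. g <#\<^bsub>trisym\<^esub> K \<alpha> \<subseteq> S" "\<forall>g\<in>T. \<exists>\<alpha>. g <#\<^bsub>trisym\<^esub> K \<alpha> \<subseteq> T"
    then show "\<forall>g\<in>S \<inter> T. \<exists>\<alpha>. g <#\<^bsub>trisym\<^esub> K \<alpha> \<subseteq> S \<inter> T"
    proof (intro ballI)
      fix g assume "g \<in> S \<inter> T"
      then obtain \<alpha> \<beta> where "g <#\<^bsub>trisym\<^esub> K \<alpha> \<subseteq> S" "g <#\<^bsub>trisym\<^esub> K \<beta> \<subseteq> T"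
        using \<open>\<forall>g\<in>S. _\<close> \<open>\<forall>g\<in>T. _\<close> by blast
      then have "g <#\<^bsub>trisym\<^esub> K (max \<alpha> \<beta>) \<subseteq> S \<inter> T" using mono[of g \<alpha> \<beta>] by blast
      then show "\<exists>\<alpha>. g <#\<^bsub>trisym\<^esub> K \<alpha> \<subseteq> S \<inter> T" ..
    qed
  next
    fix \<U> assume U: "\<forall>U\<in>\<U>. ?P U"
    then show "\<Union>\<U> \<subseteq> carrier trisym" by blast
    show "\<forall>g\<in>\<Union>\<U>. \<exists>\<alpha>. g <#\<^bsub>trisym\<^esub> K \<alpha> \<subseteq> \<Union>\<U>"
    proof
      fix g assume "g \<in> \<Union>\<U>"
      then obtain U where "U \<in> \<U>" "g \<in> U" by blast
      with U obtain \<alpha> where "g <#\<^bsub>trisym\<^esub> K \<alpha> \<subseteq> U" by blast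
      with \<open>U \<in> \<U>\<close> show "\<exists>\<alpha>. g <#\<^bsub>trisym\<^esub> K \<alpha> \<subseteq> \<Union>\<U>" by blast
    qed
  qed blast
  then show ?thesis
    by (simp add: trisym_topology_def topology_inverse')
qed

lemma topspace_trisym_topology: "topspace trisym_topology = carrier trisym"
proof
  show "topspace trisym_topology \<subseteq> carrier trisym"
    using openin_topspace openin_trisym_topology by blast
  have "g <#\<^bsub>trisym\<^esub> K 0 \<subseteq> carrier trisym" if "g \<in> carrier trisym" for g
    using that K_subset group.is_monoid[OF group_trisym] monoid.m_closed
    unfolding l_coset_def by fastforce
  then have "openin trisym_topology (carrier trisym)"
    by (auto simp: openin_trisym_topology)
  then show "carrier trisym \<subseteq> topspace trisym_topology"
    by (rule openin_subset)
qed

definition double_coset :: "nat \<Rightarrow> nat \<Rightarrow> triple \<Rightarrow> triple set" where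
  "double_coset \<alpha> \<beta> g = (K \<alpha> #>\<^bsub>trisym\<^esub> g) <#>\<^bsub>trisym\<^esub> K \<beta>"

lemma mem_double_coset:
  "h \<in> double_coset \<alpha> \<beta> g \<longleftrightarrow> (\<exists>s\<in>S_inf \<alpha>. \<exists>t\<in>S_inf \<beta>. h = (\<lambda>c. s \<circ> g c \<circ> t))"
proof
  assume "h \<in> double_coset \<alpha> \<beta> g"
  then obtain k l where "k \<in> K \<alpha>" "l \<in> K \<beta>" "h = k \<otimes>\<^bsub>trisym\<^esub> g \<otimes>\<^bsub>trisym\<^esub> l"
    unfolding double_coset_def r_coset_def set_mult_def by blast
  then show "\<exists>s\<in>S_inf \<alpha>. \<exists>t\<in>S_inf \<beta>. h = (\<lambda>c. s \<circ> g c \<circ> t)"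
    by (auto simp: K_def)
next
  assume "\<exists>s\<in>S_inf \<alpha>. \<exists>t\<in>S_inf \<beta>. h = (\<lambda>c. s \<circ> g c \<circ> t)"
  then obtain s t where "(\<lambda>c. s) \<in> K \<alpha>" "(\<lambda>c. t) \<in> K \<beta>"
    "h = (\<lambda>c. s) \<otimes>\<^bsub>trisym\<^esub> g \<otimes>\<^bsub>trisym\<^esub> (\<lambda>c. t)"
    by (auto simp: K_def)
  then show "h \<in> double_coset \<alpha> \<beta> g"
    unfolding double_coset_def r_coset_def set_mult_def by blast
qed

definition double_cosets :: "nat \<Rightarrow> nat \<Rightarrow> triple set set" where
  "double_cosets \<alpha> \<beta> = double_coset \<alpha> \<beta> ` carrier trisym"


section \<open>Unitary representations\<close>

definition unitary_rep :: "(triple \<Rightarrow> 'h::complex_hilbert \<Rightarrow> 'h) \<Rightarrow> bool" where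
  "unitary_rep \<rho> \<longleftrightarrow> \<rho> \<in> hom trisym unitary_group \<and>
     (\<forall>v. continuous_map trisym_topology euclidean (\<lambda>g. \<rho> g v))"

definition fixed_space :: "(triple \<Rightarrow> 'h::complex_hilbert \<Rightarrow> 'h) \<Rightarrow> nat \<Rightarrow> 'h set" where
  "fixed_space \<rho> \<alpha> = {v. \<forall>k\<in>K \<alpha>. \<rho> k v = v}"

definition rho_bar_elem ::
  "(triple \<Rightarrow> 'h::complex_hilbert \<Rightarrow> 'h) \<Rightarrow> nat \<Rightarrow> nat \<Rightarrow> triple \<Rightarrow> 'h \<Rightarrow> 'h" where
  "rho_bar_elem \<rho> \<alpha> \<beta> p =
     (\<lambda>v\<in>fixed_space \<rho> \<beta>. orth_proj (fixed_space \<rho> \<alpha>) (\<rho> p v))"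

text \<open>The choice of representative is immaterial, see \<open>rho_bar_double_coset\<close> below.\<close>

definition rho_bar ::
  "(triple \<Rightarrow> 'h::complex_hilbert \<Rightarrow> 'h) \<Rightarrow> nat \<Rightarrow> nat \<Rightarrow> triple set \<Rightarrow> 'h \<Rightarrow> 'h" where
  "rho_bar \<rho> \<alpha> \<beta> \<aa> = rho_bar_elem \<rho> \<alpha> \<beta> (SOME p. p \<in> \<aa>)"

lemma rho_bar_elem_double_coset:
  assumes \<rho>: "unitary_rep \<rho>" and p: "p \<in> carrier trisym" and q: "q \<in> double_coset \<alpha> \<beta> p"
  shows "rho_bar_elem \<rho> \<alpha> \<beta> q = rho_bar_elem \<rho> \<alpha> \<beta> p"
proof -
  obtain s t where s: "s \<in> S_inf \<alpha>" and t: "t \<in> S_inf \<beta>" and q_eq: "q = (\<lambda>c. s \<circ> p c \<circ> t)"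
    using q by (auto simp: mem_double_coset)
  have st: "(\<lambda>c. s) \<in> K \<alpha>" "(\<lambda>c. t) \<in> K \<beta>" using s t by (auto simp: K_def)
  have mult: "\<rho> (g \<otimes>\<^bsub>trisym\<^esub> h) = \<rho> g \<circ> \<rho> h"
    if "g \<in> carrier trisym" "h \<in> carrier trisym" for g h
    using \<rho> that by (auto simp: unitary_rep_def hom_def unitary_group_def)
  have pt: "p \<otimes>\<^bsub>trisym\<^esub> (\<lambda>c. t) \<in> carrier trisym"
    using group.is_monoid[OF group_trisym] K_subset st p by (blast intro: monoid.m_closed)
  have q': "\<rho> q = \<rho> (\<lambda>c. s) \<circ> (\<rho> p \<circ> \<rho> (\<lambda>c. t))"
    using mult[of "\<lambda>c. s" "p \<otimes>\<^bsub>trisym\<^esub> (\<lambda>c. t)"] mult[of p "\<lambda>c. t"] pt p st K_subset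
    by (auto simp: q_eq o_assoc subset_iff)
  have uni: "cinner (\<rho> (\<lambda>c. s) x) (\<rho> (\<lambda>c. s) y) = cinner x y" for x y
  proof -
    have "(\<lambda>c. s) \<in> carrier trisym" using st K_subset by blast
    with \<rho> have "\<rho> (\<lambda>c. s) \<in> carrier unitary_group"
      by (auto simp: unitary_rep_def hom_def)
    then show ?thesis by (simp add: unitary_group_def)
  qed
  have diff: "cinner (x - y) z = cinner x z - cinner y z" for x y z :: 'a
    using cinner_add_left[of "x - y" y z] by simp
  have "orth_proj (fixed_space \<rho> \<alpha>) (\<rho> (\<lambda>c. s) x) = orth_proj (fixed_space \<rho> \<alpha>) x" for x
  proof -
    have "cinner (\<rho> (\<lambda>c. s) x) z = cinner x z" if "z \<in> fixed_space \<rho> \<alpha>" for z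
      using uni[of x z] that st by (simp add: fixed_space_def)
    then show ?thesis by (simp add: orth_proj_def diff)
  qed
  moreover have "\<rho> (\<lambda>c. t) v = v" if "v \<in> fixed_space \<rho> \<beta>" for v
    using that st by (simp add: fixed_space_def)
  ultimately show ?thesis
    by (auto simp: rho_bar_elem_def q' fun_eq_iff)
qed

lemma rho_bar_double_coset:
  assumes "unitary_rep \<rho>" "p \<in> carrier trisym"
  shows "rho_bar \<rho> \<alpha> \<beta> (double_coset \<alpha> \<beta> p) = rho_bar_elem \<rho> \<alpha> \<beta> p"
proof -
  have "p \<in> double_coset \<alpha> \<beta> p"
    unfolding mem_double_coset
    by (rule bexI[OF bexI[OF _ S_inf_id] S_inf_id]) simp
  then have "(SOME q. q \<in> double_coset \<alpha> \<beta> p) \<in> double_coset \<alpha> \<beta> p"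
    by (rule someI[where P = "\<lambda>q. q \<in> double_coset \<alpha> \<beta> p"])
  then show ?thesis
    using assms by (simp add: rho_bar_def rho_bar_elem_double_coset)
qed


section \<open>Boards\<close>

text \<open>
  Black and white triangles are two separate sorts: an element of \<^typ>\<open>'a\<close> in \<open>black B \<inter> white B\<close>
  names two different triangles. The triangle across the \<open>c\<close>-edge of the black triangle \<open>x\<close> is the
  white triangle \<open>adj B c x\<close>. Coloring and orientation of the surface are determined by these data.
  In an \<open>(\<alpha>, \<beta>)\<close>-board only \<open>black_label j\<close> for \<open>1 \<le> j \<le> \<beta>\<close> and \<open>white_label j\<close> for
  \<open>1 \<le> j \<le> \<alpha>\<close> are significant: they are the triangles labeled \<open>j\<close>.
\<close>

record 'a board =
  black :: "'a set"
  white :: "'a set"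
  adj :: "color \<Rightarrow> 'a \<Rightarrow> 'a"
  black_label :: "nat \<Rightarrow> 'a"
  white_label :: "nat \<Rightarrow> 'a"

text \<open>The black triangles of the empty chebureks.\<close>

definition empty_chebureks :: "nat \<Rightarrow> nat \<Rightarrow> 'a board \<Rightarrow> 'a set" where
  "empty_chebureks \<alpha> \<beta> B =
     {x \<in> black B. x \<notin> black_label B ` {1..\<beta>} \<and>
        (\<exists>w. (\<forall>c. adj B c x = w) \<and> w \<notin> white_label B ` {1..\<alpha>})}"

definition delete_empty_chebureks :: "nat \<Rightarrow> nat \<Rightarrow> 'a board \<Rightarrow> 'a board" where
  "delete_empty_chebureks \<alpha> \<beta> B =
     B\<lparr>black := black B - empty_chebureks \<alpha> \<beta> B,
       white := white B - adj B Red ` empty_chebureks \<alpha> \<beta> B\<rparr>"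

definition is_board :: "nat \<Rightarrow> nat \<Rightarrow> 'a board \<Rightarrow> bool" where
  "is_board \<alpha> \<beta> B \<longleftrightarrow>
     finite (black B) \<and> finite (white B) \<and>
     (\<forall>c. bij_betw (adj B c) (black B) (white B)) \<and>
     inj_on (black_label B) {1..\<beta>} \<and> black_label B ` {1..\<beta>} \<subseteq> black B \<and>
     inj_on (white_label B) {1..\<alpha>} \<and> white_label B ` {1..\<alpha>} \<subseteq> white B \<and>
     empty_chebureks \<alpha> \<beta> B = {}"

definition board_iso :: "nat \<Rightarrow> nat \<Rightarrow> 'a board \<Rightarrow> 'b board \<Rightarrow> bool" where
  "board_iso \<alpha> \<beta> A B \<longleftrightarrow> (\<exists>\<phi> \<psi>.
     bij_betw \<phi> (black A) (black B) \<and> bij_betw \<psi> (white A) (white B) \<and>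
     (\<forall>c. \<forall>x\<in>black A. adj B c (\<phi> x) = \<psi> (adj A c x)) \<and>
     (\<forall>j\<in>{1..\<beta>}. \<phi> (black_label A j) = black_label B j) \<and>
     (\<forall>j\<in>{1..\<alpha>}. \<psi> (white_label A j) = white_label B j))"

text \<open>
  Since boards are finite, every isomorphism class is represented on the naturals.
\<close>

definition board_class :: "nat \<Rightarrow> nat \<Rightarrow> 'a board \<Rightarrow> nat board set" where
  "board_class \<alpha> \<beta> B = {C. is_board \<alpha> \<beta> C \<and> board_iso \<alpha> \<beta> B C}"

definition boards :: "nat \<Rightarrow> nat \<Rightarrow> nat board set set" where
  "boards \<alpha> \<beta> = board_class \<alpha> \<beta> ` {B :: nat board. is_board \<alpha> \<beta> B}"


section \<open>Double cosets as boards\<close>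

definition board_of :: "nat \<Rightarrow> nat \<Rightarrow> triple \<Rightarrow> nat board" where
  "board_of \<alpha> \<beta> g = delete_empty_chebureks \<alpha> \<beta>
     \<lparr>black = {1..}, white = {1..}, adj = g, black_label = id, white_label = id\<rparr>"

definition coset_board :: "nat \<Rightarrow> nat \<Rightarrow> triple set \<Rightarrow> nat board set" where
  "coset_board \<alpha> \<beta> \<aa> = (\<Union>g\<in>\<aa>. board_class \<alpha> \<beta> (board_of \<alpha> \<beta> g))"

lemma board_iso_refl: "board_iso \<alpha> \<beta> A A"
  unfolding board_iso_def by (intro exI[of _ id]) auto

lemma board_iso_trans:
  assumes "board_iso \<alpha> \<beta> A B" "board_iso \<alpha> \<beta> B C"
  shows "board_iso \<alpha> \<beta> A C"
proof -
  obtain \<phi> \<psi> where 1: "bij_betw \<phi> (black A) (black B)" "bij_betw \<psi> (white A) (white B)"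
    "\<And>c x. x \<in> black A \<Longrightarrow> adj B c (\<phi> x) = \<psi> (adj A c x)"
    "\<And>j. j \<in> {1..\<beta>} \<Longrightarrow> \<phi> (black_label A j) = black_label B j"
    "\<And>j. j \<in> {1..\<alpha>} \<Longrightarrow> \<psi> (white_label A j) = white_label B j"
    using assms(1) by (auto simp: board_iso_def)
  obtain \<phi>' \<psi>' where 2: "bij_betw \<phi>' (black B) (black C)" "bij_betw \<psi>' (white B) (white C)"
    "\<And>c x. x \<in> black B \<Longrightarrow> adj C c (\<phi>' x) = \<psi>' (adj B c x)"
    "\<And>j. j \<in> {1..\<beta>} \<Longrightarrow> \<phi>' (black_label B j) = black_label C j"
    "\<And>j. j \<in> {1..\<alpha>} \<Longrightarrow> \<psi>' (white_label B j) = white_label C j"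
    using assms(2) by (auto simp: board_iso_def)
  have "\<phi> x \<in> black B" if "x \<in> black A" for x
    using 1(1) that by (auto simp: bij_betw_def)
  with 1 2 show ?thesis
    unfolding board_iso_def
    by (intro exI[of _ "\<phi>' \<circ> \<phi>"] exI[of _ "\<psi>' \<circ> \<psi>"]) (auto intro: bij_betw_trans)
qed

lemma board_iso_sym:
  assumes A: "is_board \<alpha> \<beta> A" and "board_iso \<alpha> \<beta> A B"
  shows "board_iso \<alpha> \<beta> B A"
proof -
  obtain \<phi> \<psi> where 1: "bij_betw \<phi> (black A) (black B)" "bij_betw \<psi> (white A) (white B)"
    "\<And>c x. x \<in> black A \<Longrightarrow> adj B c (\<phi> x) = \<psi> (adj A c x)"
    "\<And>j. j \<in> {1..\<beta>} \<Longrightarrow> \<phi> (black_label A j) = black_label B j"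
    "\<And>j. j \<in> {1..\<alpha>} \<Longrightarrow> \<psi> (white_label A j) = white_label B j"
    using assms(2) by (auto simp: board_iso_def)
  let ?\<phi> = "inv_into (black A) \<phi>" and ?\<psi> = "inv_into (white A) \<psi>"
  have inv: "?\<phi> (\<phi> x) = x" "?\<psi> (\<psi> w) = w" if "x \<in> black A" "w \<in> white A" for x w
    using 1(1,2) that by (auto simp: bij_betw_def)
  have "adj A c (?\<phi> y) = ?\<psi> (adj B c y)" if y: "y \<in> black B" for c y
  proof -
    obtain x where x: "x \<in> black A" "y = \<phi> x" using 1(1) y by (auto simp: bij_betw_def)
    moreover have "adj A c x \<in> white A" using A x by (auto simp: is_board_def bij_betw_def)
    ultimately show ?thesis using inv 1(3) by metis
  qed
  moreover have "?\<phi> (black_label B j) = black_label A j" if "j \<in> {1..\<beta>}" for j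
  proof -
    have "black_label A j \<in> black A" using A that by (auto simp: is_board_def)
    then show ?thesis using 1(1,4) that by (metis bij_betw_inv_into_left)
  qed
  moreover have "?\<psi> (white_label B j) = white_label A j" if "j \<in> {1..\<alpha>}" for j
  proof -
    have "white_label A j \<in> white A" using A that by (auto simp: is_board_def)
    then show ?thesis using 1(2,5) that by (metis bij_betw_inv_into_left)
  qed
  ultimately show ?thesis
    using 1(1,2) unfolding board_iso_def
    by (intro exI[of _ ?\<phi>] exI[of _ ?\<psi>]) (auto intro: bij_betw_inv_into)
qed

text \<open>
  The empty chebureks of an element of the group, before deletion. The remaining lemmas of this
  section show that \<open>coset_board\<close> is a bijection, which is what makes the identification of
  double cosets with boards legitimate.
\<close>

definition cheb :: "nat \<Rightarrow> nat \<Rightarrow> triple \<Rightarrow> nat set" where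
  "cheb \<alpha> \<beta> g = {i. i > \<beta> \<and> g Red i > \<alpha> \<and> g Yellow i = g Red i \<and> g Blue i = g Red i}"

lemma cheb_eq: "i \<in> cheb \<alpha> \<beta> g \<Longrightarrow> g c i = g Red i"
  by (cases c) (simp_all add: cheb_def)

lemma empty_chebureks_triple:
  assumes "g \<in> carrier trisym"
  shows "empty_chebureks \<alpha> \<beta>
     \<lparr>black = {1..}, white = {1..}, adj = g, black_label = id, white_label = id\<rparr> = cheb \<alpha> \<beta> g"
proof -
  have pos: "g Red i \<ge> 1" if "i \<ge> 1" for i
    using assms that permutes_in_image[of "g Red" "{1..}" i] by (simp add: carrier_trisym_iff)
  have all: "(\<forall>c. g c i = w) \<longleftrightarrow> g Red i = w \<and> g Yellow i = w \<and> g Blue i = w" for i w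
  proof
    assume "g Red i = w \<and> g Yellow i = w \<and> g Blue i = w"
    then have "g c i = w" for c by (cases c) simp_all
    then show "\<forall>c. g c i = w" ..
  qed simp
  show ?thesis
  proof (rule Set.set_eqI)
    fix i
    show "i \<in> empty_chebureks \<alpha> \<beta>
        \<lparr>black = {1..}, white = {1..}, adj = g, black_label = id, white_label = id\<rparr> \<longleftrightarrow>
      i \<in> cheb \<alpha> \<beta> g"
    proof (cases "i \<ge> 1")
      case True
      then show ?thesis
        using pos[OF True] by (simp add: empty_chebureks_def cheb_def all not_le) blast
    qed (simp add: empty_chebureks_def cheb_def)
  qed
qed

lemma board_of_simps:
  assumes "g \<in> carrier trisym"
  shows "black (board_of \<alpha> \<beta> g) = {1..} - cheb \<alpha> \<beta> g"
    "white (board_of \<alpha> \<beta> g) = {1..} - g Red ` cheb \<alpha> \<beta> g"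
    "adj (board_of \<alpha> \<beta> g) = g"
    "black_label (board_of \<alpha> \<beta> g) = id"
    "white_label (board_of \<alpha> \<beta> g) = id"
  using empty_chebureks_triple[OF assms]
  by (simp_all add: board_of_def delete_empty_chebureks_def)

lemma cofinite_cheb:
  assumes g: "g \<in> carrier trisym"
  shows "finite (- cheb \<alpha> \<beta> g)"
proof (rule finite_subset)
  show "- cheb \<alpha> \<beta> g \<subseteq> {..\<beta>} \<union> g Red -` {..\<alpha>} \<union>
      ({i. g Yellow i \<noteq> g Red i} \<union> {i. g Blue i \<noteq> g Red i})"
  proof
    fix i assume i: "i \<in> - cheb \<alpha> \<beta> g"
    with i show "i \<in> {..\<beta>} \<union> g Red -` {..\<alpha>} \<union>
        ({i. g Yellow i \<noteq> g Red i} \<union> {i. g Blue i \<noteq> g Red i})"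
      by (auto simp: cheb_def)
  qed
  have "g Red permutes {1..}" using g by (simp add: carrier_trisym_iff)
  then have "inj (g Red)" by (rule permutes_inj)
  then show "finite ({..\<beta>} \<union> g Red -` {..\<alpha>} \<union>
      ({i. g Yellow i \<noteq> g Red i} \<union> {i. g Blue i \<noteq> g Red i}))"
    using g by (intro finite_UnI finite_vimageI) (auto simp: carrier_trisym_iff)
qed

lemma infinite_cheb: "g \<in> carrier trisym \<Longrightarrow> infinite (cheb \<alpha> \<beta> g)"
  using cofinite_cheb[where \<alpha> = \<alpha> and \<beta> = \<beta>, of g] finite_compl[of "cheb \<alpha> \<beta> g"] by blast

lemma is_board_board_of:
  assumes g: "g \<in> carrier trisym"
  shows "is_board \<alpha> \<beta> (board_of \<alpha> \<beta> g)"
proof -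
  let ?E = "cheb \<alpha> \<beta> g"
  have bij: "bij_betw (g c) {1..} {1..}" for c
    using g by (auto simp: carrier_trisym_iff intro: permutes_imp_bij)
  have im: "g c ` ?E = g Red ` ?E" for c
    by (intro image_cong cheb_eq) auto
  have E: "?E \<subseteq> {1..}" by (auto simp: cheb_def)
  have b: "bij_betw (g c) ({1..} - ?E) ({1..} - g Red ` ?E)" for c
  proof (rule bij_betw_imageI)
    show "inj_on (g c) ({1..} - ?E)"
      using bij[of c] by (auto simp: bij_betw_def inj_on_diff)
    have "g c ` ({1..} - ?E) = g c ` {1..} - g c ` ?E"
      using bij[of c] E by (intro inj_on_image_set_diff[of _ "{1..}"]) (auto simp: bij_betw_def)
    then show "g c ` ({1..} - ?E) = {1..} - g Red ` ?E"
      using bij[of c] im[of c] by (simp add: bij_betw_def)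
  qed
  have fin: "finite ({1..} - ?E)"
    by (rule finite_subset[OF _ cofinite_cheb[OF g, where \<alpha> = \<alpha> and \<beta> = \<beta>]]) auto
  have w: "{1..\<alpha>} \<subseteq> {1..} - g Red ` ?E" by (auto simp: cheb_def)
  have "empty_chebureks \<alpha> \<beta> (board_of \<alpha> \<beta> g) = {}"
  proof -
    have "False" if "x \<in> empty_chebureks \<alpha> \<beta> (board_of \<alpha> \<beta> g)" for x
    proof -
      have "x \<in> empty_chebureks \<alpha> \<beta>
        \<lparr>black = {1..}, white = {1..}, adj = g, black_label = id, white_label = id\<rparr>" "x \<notin> ?E"
        using that unfolding empty_chebureks_def[of _ _ "board_of \<alpha> \<beta> g"] board_of_simps[OF g]
        by (auto simp: empty_chebureks_def)
      then show False using empty_chebureks_triple[OF g] by metis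
    qed
    then show ?thesis by blast
  qed
  moreover have "{1..\<beta>} \<subseteq> {1..} - ?E" by (auto simp: cheb_def)
  ultimately show ?thesis
    unfolding is_board_def board_of_simps[OF g]
    using b fin w bij_betw_finite[OF b[of Red]] by simp
qed

lemma double_coset_closed:
  assumes "g \<in> carrier trisym" "h \<in> double_coset \<alpha> \<beta> g"
  shows "h \<in> carrier trisym"
proof -
  obtain s t where st: "s \<in> S_inf \<alpha>" "t \<in> S_inf \<beta>" "h = (\<lambda>c. s \<circ> g c \<circ> t)"
    using assms by (auto simp: mem_double_coset)
  then have "(\<lambda>c. s) \<in> carrier trisym" "(\<lambda>c. t) \<in> carrier trisym"
    using K_subset by (auto simp: K_def)
  then have "((\<lambda>c. s) \<otimes>\<^bsub>trisym\<^esub> g) \<otimes>\<^bsub>trisym\<^esub> (\<lambda>c. t) \<in> carrier trisym"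
    using assms(1) group.is_monoid[OF group_trisym] by (blast intro: monoid.m_closed)
  then show ?thesis using st by simp
qed

lemma S_inf_gt:
  assumes "s \<in> S_inf \<alpha>"
  shows "s i > \<alpha> \<longleftrightarrow> i > \<alpha>"
proof -
  have s: "s permutes {1..}" and fixed: "\<And>i. i \<in> {1..\<alpha>} \<Longrightarrow> s i = i"
    using assms by (auto simp: S_inf_def)
  have fixed': "s i = i" if "i \<le> \<alpha>" for i
  proof (cases "i = 0")
    case True
    then show ?thesis using s by (simp add: permutes_def)
  qed (use that fixed in simp)
  show ?thesis
  proof (rule iffI; rule ccontr)
    assume "s i > \<alpha>" "\<not> i > \<alpha>"
    then show False using fixed'[of i] by simp
  next
    assume i: "i > \<alpha>" "\<not> s i > \<alpha>"
    then have "s (s i) = s i" using fixed'[of "s i"] by simp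
    then have "s i = i" using permutes_inj[OF s] by (simp add: inj_eq)
    then show False using i by simp
  qed
qed

lemma board_iso_double_coset:
  assumes g: "g \<in> carrier trisym" and h: "h \<in> double_coset \<alpha> \<beta> g"
  shows "board_iso \<alpha> \<beta> (board_of \<alpha> \<beta> h) (board_of \<alpha> \<beta> g)"
proof -
  obtain s t where s: "s \<in> S_inf \<alpha>" and t: "t \<in> S_inf \<beta>" and h_eq: "h = (\<lambda>c. s \<circ> g c \<circ> t)"
    using h by (auto simp: mem_double_coset)
  have hc: "h \<in> carrier trisym" using double_coset_closed[OF g h] .
  have sp: "s permutes {1..}" and tp: "t permutes {1..}" using s t by (auto simp: S_inf_def)
  let ?s = "inv_into UNIV s"
  have s': "?s \<in> S_inf \<alpha>" and s'p: "?s permutes {1..}" using S_inf_inv[OF s] by (auto simp: S_inf_def)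
  have im: "t ` cheb \<alpha> \<beta> h = cheb \<alpha> \<beta> g"
  proof -
    have "i \<in> cheb \<alpha> \<beta> h \<longleftrightarrow> t i \<in> cheb \<alpha> \<beta> g" for i
      using S_inf_gt[OF s] S_inf_gt[OF t] permutes_inj[OF sp] by (simp add: cheb_def h_eq inj_eq)
    moreover have "surj t" using tp by (rule permutes_surj)
    ultimately have "cheb \<alpha> \<beta> h = t -` cheb \<alpha> \<beta> g" by blast
    with \<open>surj t\<close> show ?thesis by (simp add: surj_image_vimage_eq)
  qed
  have im': "?s ` h Red ` cheb \<alpha> \<beta> h = g Red ` cheb \<alpha> \<beta> g"
    using permutes_inverses(2)[OF sp] by (simp add: im[symmetric] h_eq image_image)
  have 1: "bij_betw t ({1..} - cheb \<alpha> \<beta> h) ({1..} - cheb \<alpha> \<beta> g)"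
    using permutes_inj_on[OF tp] permutes_image[OF tp] im
    by (simp add: bij_betw_def image_set_diff[OF permutes_inj[OF tp]])
  have 2: "bij_betw ?s ({1..} - h Red ` cheb \<alpha> \<beta> h) ({1..} - g Red ` cheb \<alpha> \<beta> g)"
    using permutes_inj_on[OF s'p] permutes_image[OF s'p] im'
    by (simp add: bij_betw_def image_set_diff[OF permutes_inj[OF s'p]])
  show ?thesis
    unfolding board_iso_def board_of_simps[OF g] board_of_simps[OF hc]
    using 1 2 s' t permutes_inverses(2)[OF sp]
    by (intro exI[of _ t] exI[of _ ?s]) (simp add: h_eq S_inf_def)
qed

lemma double_coset_if_board_iso:
  assumes g: "g \<in> carrier trisym" and h: "h \<in> carrier trisym"
    and iso: "board_iso \<alpha> \<beta> (board_of \<alpha> \<beta> g) (board_of \<alpha> \<beta> h)"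
  shows "h \<in> double_coset \<alpha> \<beta> g"
proof -
  let ?E = "cheb \<alpha> \<beta> g" and ?F = "cheb \<alpha> \<beta> h"
  obtain \<phi> \<psi> where \<phi>: "bij_betw \<phi> ({1..} - ?E) ({1..} - ?F)"
    and \<psi>: "bij_betw \<psi> ({1..} - g Red ` ?E) ({1..} - h Red ` ?F)"
    and adj: "\<And>c i. i \<in> {1..} - ?E \<Longrightarrow> h c (\<phi> i) = \<psi> (g c i)"
    and lab: "\<And>j. j \<in> {1..\<beta>} \<Longrightarrow> \<phi> j = j" "\<And>j. j \<in> {1..\<alpha>} \<Longrightarrow> \<psi> j = j"
    using iso unfolding board_iso_def board_of_simps[OF g] board_of_simps[OF h] by auto
  obtain e where e: "bij_betw e ?E ?F"
  proof -
    have "bij_betw (from_nat_into ?F \<circ> to_nat_on ?E) ?E ?F"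
      using infinite_cheb[OF g] infinite_cheb[OF h]
      by (intro bij_betw_trans[OF to_nat_on_infinite bij_betw_from_nat_into]) auto
    then show thesis by (rule that)
  qed
  have gp: "g c permutes {1..}" and hp: "h c permutes {1..}" for c
    using g h by (auto simp: carrier_trisym_iff)
  have gE: "g Red ` ?E \<subseteq> {1..}" "h Red ` ?F \<subseteq> {1..}" and E: "?E \<subseteq> {1..}" "?F \<subseteq> {1..}"
    by (auto simp: cheb_def)
  let ?gi = "inv_into UNIV (g Red)"
  define t where "t i = (if i \<in> ?E then e i else if i = 0 then 0 else \<phi> i)" for i
  define s where "s i = (if i \<in> g Red ` ?E then h Red (e (?gi i)) else if i = 0 then 0 else \<psi> i)"
    for i
  have gi: "?gi (g Red i) = i" for i using permutes_inverses[OF gp] by metis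
  have "bij_betw t (?E \<union> ({1..} - ?E)) (?F \<union> ({1..} - ?F))"
  proof (rule bij_betw_combine)
    show "bij_betw t ?E ?F" using e by (rule bij_betw_cong[THEN iffD1, rotated]) (simp add: t_def)
    show "bij_betw t ({1..} - ?E) ({1..} - ?F)"
      using \<phi> by (rule bij_betw_cong[THEN iffD1, rotated]) (auto simp: t_def)
  qed auto
  moreover have "?E \<union> ({1..} - ?E) = {1..}" "?F \<union> ({1..} - ?F) = {1..}" using E by blast+
  ultimately have "bij_betw t {1..} {1..}" by metis
  then have "t permutes {1..}"
    by (rule bij_imp_permutes) (use E in \<open>auto simp: t_def\<close>)
  moreover have "t i = i" if "i \<in> {1..\<beta>}" for i using that lab by (auto simp: t_def cheb_def)
  ultimately have t: "t \<in> S_inf \<beta>" by (simp add: S_inf_def)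
  have "bij_betw s (g Red ` ?E \<union> ({1..} - g Red ` ?E)) (h Red ` ?F \<union> ({1..} - h Red ` ?F))"
  proof (rule bij_betw_combine)
    have "bij_betw (h Red \<circ> (e \<circ> ?gi)) (g Red ` ?E) (h Red ` ?F)"
    proof (intro bij_betw_trans)
      show "bij_betw ?gi (g Red ` ?E) ?E" 
        using gi by (intro bij_betw_imageI inj_onI) (auto simp: image_image)
      show "bij_betw (h Red) ?F (h Red ` ?F)"
        using permutes_inj_on[OF hp] by (auto simp: bij_betw_def)
    qed (rule e)
    then show "bij_betw s (g Red ` ?E) (h Red ` ?F)"
      by (rule bij_betw_cong[THEN iffD1, rotated]) (simp add: s_def)
    show "bij_betw s ({1..} - g Red ` ?E) ({1..} - h Red ` ?F)"
      using \<psi> by (rule bij_betw_cong[THEN iffD1, rotated]) (auto simp: s_def)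
  qed auto
  moreover have "g Red ` ?E \<union> ({1..} - g Red ` ?E) = {1..}" "h Red ` ?F \<union> ({1..} - h Red ` ?F) = {1..}"
    using gE by blast+
  ultimately have "bij_betw s {1..} {1..}" by metis
  then have sp: "s permutes {1..}"
    by (rule bij_imp_permutes) (use gE in \<open>auto simp: s_def\<close>)
  moreover have "s i = i" if i: "i \<in> {1..\<alpha>}" for i
  proof -
    have "i \<notin> g Red ` ?E" using i by (auto simp: cheb_def)
    then show ?thesis using i lab by (simp add: s_def)
  qed
  ultimately have s: "s \<in> S_inf \<alpha>" by (simp add: S_inf_def)
  have eq: "h c (t i) = s (g c i)" for c i
  proof -
    consider "i \<in> ?E" | "i = 0" "i \<notin> ?E" | "i \<in> {1..} - ?E"
      by (cases "i = 0"; cases "i \<in> ?E") auto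
    then show ?thesis
    proof cases
      case 1
      then have "e i \<in> ?F" using e by (auto simp: bij_betw_def)
      then have "h c (e i) = h Red (e i)" by (rule cheb_eq)
      moreover have "g c i = g Red i" using 1 by (rule cheb_eq)
      ultimately show ?thesis using 1 gi by (simp add: t_def s_def)
    next
      case 2
      have "g c 0 = 0" "h c 0 = 0" using gp[of c] hp[of c] by (simp_all add: permutes_def)
      moreover have "0 \<notin> g Red ` ?E" using gE by auto
      ultimately show ?thesis using 2 by (simp add: t_def s_def)
    next
      case 3
      have "g c i \<notin> g Red ` ?E"
      proof
        assume "g c i \<in> g Red ` ?E"
        then obtain j where "j \<in> ?E" "g c i = g Red j" by blast
        moreover have "g c j = g Red j" using \<open>j \<in> ?E\<close> by (rule cheb_eq)
        ultimately have "g c i = g c j" "j \<in> ?E" by simp_all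
        then have "i = j" using permutes_inj[OF gp] by (metis injD)
        then show False using 3 \<open>j \<in> ?E\<close> by blast
      qed
      moreover have "g c i \<noteq> 0"
        using 3 permutes_in_image[OF gp, of c i] by auto
      ultimately show ?thesis using 3 adj[OF 3] by (simp add: t_def s_def)
    qed
  qed
  have tp: "t permutes {1..}" using t by (simp add: S_inf_def)
  have "h = (\<lambda>c. s \<circ> g c \<circ> inv_into UNIV t)"
    using permutes_inverses(1)[OF tp] eq by (simp add: fun_eq_iff flip: eq)
  then show ?thesis
    using s S_inf_inv[OF t] by (auto simp: mem_double_coset)
qed

lemma ex_board_of_iso:
  assumes B: "is_board \<alpha> \<beta> B"
  shows "\<exists>g\<in>carrier trisym. board_iso \<alpha> \<beta> (board_of \<alpha> \<beta> g) B"
proof -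
  define n where "n = card (black B)"
  have fin: "finite (black B)" "finite (white B)" and
    adj: "bij_betw (adj B c) (black B) (white B)" and
    bl: "inj_on (black_label B) {1..\<beta>}" "black_label B ` {1..\<beta>} \<subseteq> black B" and
    wl: "inj_on (white_label B) {1..\<alpha>}" "white_label B ` {1..\<alpha>} \<subseteq> white B" and
    E: "empty_chebureks \<alpha> \<beta> B = {}" for c
    using B by (auto simp: is_board_def)
  have n': "card (white B) = n" using bij_betw_same_card[OF adj] by (simp add: n_def)
  have ext: "\<exists>p. bij_betw p {1..n} X \<and> (\<forall>j\<in>{1..m}. p j = l j) \<and> m \<le> n"
    if l: "inj_on l {1..m}" "l ` {1..m} \<subseteq> X" and X: "finite X" "card X = n"
    for l m and X :: "'a set"
  proof -
    have m: "m \<le> n" using card_inj_on_le[OF l X(1)] X(2) by simp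
    have "card ({1..n} - {1..m}) = card (X - l ` {1..m})"
      using m X l card_image[OF l(1)] by (simp add: card_Diff_subset)
    then obtain f where f: "bij_betw f ({1..n} - {1..m}) (X - l ` {1..m})"
      using X(1) finite_same_card_bij[of "{1..n} - {1..m}" "X - l ` {1..m}"] by auto
    define p where "p j = (if j \<in> {1..m} then l j else f j)" for j
    have "bij_betw p ({1..m} \<union> ({1..n} - {1..m})) (l ` {1..m} \<union> (X - l ` {1..m}))"
    proof (rule bij_betw_combine)
      show "bij_betw p {1..m} (l ` {1..m})"
        using l(1) by (intro bij_betw_cong[THEN iffD1, OF _ inj_on_imp_bij_betw]) (auto simp: p_def)
      show "bij_betw p ({1..n} - {1..m}) (X - l ` {1..m})"
        using f by (rule bij_betw_cong[THEN iffD1, rotated]) (auto simp: p_def)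
    qed auto
    moreover have "{1..m} \<union> ({1..n} - {1..m}) = {1..n}" "l ` {1..m} \<union> (X - l ` {1..m}) = X"
      using m l(2) by auto
    ultimately have "bij_betw p {1..n} X" by (simp only:)
    then show ?thesis using m by (auto simp: p_def)
  qed
  obtain p where p: "bij_betw p {1..n} (black B)" "\<And>j. j \<in> {1..\<beta>} \<Longrightarrow> p j = black_label B j"
    and \<beta>: "\<beta> \<le> n"
    using ext[OF bl fin(1) n_def[symmetric]] by blast
  obtain q where q: "bij_betw q {1..n} (white B)" "\<And>j. j \<in> {1..\<alpha>} \<Longrightarrow> q j = white_label B j"
    and \<alpha>: "\<alpha> \<le> n"
    using ext[OF wl fin(2) n'] by blast
  define g where "g c i = (if i \<in> {1..n} then inv_into {1..n} q (adj B c (p i)) else i)" for c i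
  have bij: "bij_betw (g c) {1..n} {1..n}" for c
  proof -
    have "bij_betw (inv_into {1..n} q \<circ> (adj B c \<circ> p)) {1..n} {1..n}"
      by (intro bij_betw_trans[OF _ bij_betw_inv_into[OF q(1)]] bij_betw_trans[OF p(1) adj])
    then show ?thesis
      by (rule bij_betw_cong[THEN iffD1, rotated]) (simp add: g_def)
  qed
  then have "g c permutes {1..n}" for c
    by (rule bij_imp_permutes) (auto simp: g_def)
  then have perm: "g c permutes {1..}" for c
    by (rule permutes_subset) auto
  have "finite {i. g c i \<noteq> g d i}" for c d
    by (rule finite_subset[of _ "{1..n}"]) (auto simp: g_def)
  with perm have g: "g \<in> carrier trisym" by (simp add: carrier_trisym_iff)
  have qg: "q (g c i) = adj B c (p i)" if "i \<in> {1..n}" for c i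
  proof -
    have "adj B c (p i) \<in> white B"
      by (rule bij_betwE[OF adj, rule_format, OF bij_betwE[OF p(1), rule_format, OF that]])
    then show ?thesis using that q(1) by (simp add: g_def bij_betw_inv_into_right)
  qed
  have cheb: "cheb \<alpha> \<beta> g = {n<..}"
  proof -
    have "i \<notin> cheb \<alpha> \<beta> g" if i: "i \<in> {1..n}" for i
    proof
      assume c: "i \<in> cheb \<alpha> \<beta> g"
      have "p i \<in> black B" by (rule bij_betwE[OF p(1), rule_format, OF i])
      moreover have "p i \<notin> black_label B ` {1..\<beta>}"
      proof
        assume "p i \<in> black_label B ` {1..\<beta>}"
        then obtain j where j: "j \<in> {1..\<beta>}" "p i = p j" using p(2) by (metis imageE)
        moreover have "j \<in> {1..n}" using j \<beta> by simp
        ultimately have "i = j"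
          using i by (intro inj_onD[OF bij_betw_imp_inj_on[OF p(1)]])
        then show False using j c by (simp add: cheb_def)
      qed
      moreover have "adj B Red (p i) \<notin> white_label B ` {1..\<alpha>}"
      proof
        assume "adj B Red (p i) \<in> white_label B ` {1..\<alpha>}"
        then obtain j where j: "j \<in> {1..\<alpha>}" "q (g Red i) = q j"
          using q(2) qg[OF i] by (metis imageE)
        moreover have "g Red i \<in> {1..n}" by (rule bij_betwE[OF bij, rule_format, OF i])
        moreover have "j \<in> {1..n}" using j \<alpha> by simp
        ultimately have "g Red i = j"
          by (intro inj_onD[OF bij_betw_imp_inj_on[OF q(1)]])
        then show False using j c by (simp add: cheb_def)
      qed
      moreover have "\<forall>c. adj B c (p i) = adj B Red (p i)"
      proof
        show "adj B c (p i) = adj B Red (p i)" for c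
          by (simp only: cheb_eq[OF c, of c] flip: qg[OF i])
      qed
      ultimately have "p i \<in> empty_chebureks \<alpha> \<beta> B"
        unfolding empty_chebureks_def
        by (intro CollectI conjI exI[of _ "adj B Red (p i)"])
      then show False using E by simp
    qed
    moreover have "i \<in> cheb \<alpha> \<beta> g" if "i > n" for i using that \<alpha> \<beta> by (simp add: cheb_def g_def)
    moreover have "0 \<notin> cheb \<alpha> \<beta> g" by (simp add: cheb_def)
    ultimately have "i \<in> cheb \<alpha> \<beta> g \<longleftrightarrow> i > n" for i
      by (cases "i = 0"; cases "i > n") auto
    then show ?thesis by blast
  qed
  have "g Red ` {n<..} = {n<..}" by (auto simp: g_def image_iff)
  moreover have "{1..} - {n<..} = {1..n}" by auto
  ultimately show ?thesis
    using p q qg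
    by (intro bexI[OF _ g], unfold board_iso_def board_of_simps[OF g] cheb)
      (intro exI[of _ p] exI[of _ q], simp)
qed

lemma board_class_eq:
  assumes "is_board \<alpha> \<beta> A" "board_iso \<alpha> \<beta> A B"
  shows "board_class \<alpha> \<beta> A = board_class \<alpha> \<beta> B"
  using board_iso_sym[OF assms] assms(2) unfolding board_class_def
  by (blast intro: board_iso_trans)

lemma coset_board_double_coset:
  assumes g: "g \<in> carrier trisym"
  shows "coset_board \<alpha> \<beta> (double_coset \<alpha> \<beta> g) = board_class \<alpha> \<beta> (board_of \<alpha> \<beta> g)"
proof -
  have "board_class \<alpha> \<beta> (board_of \<alpha> \<beta> h) = board_class \<alpha> \<beta> (board_of \<alpha> \<beta> g)"
    if "h \<in> double_coset \<alpha> \<beta> g" for h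
    using that g
    by (intro board_class_eq is_board_board_of board_iso_double_coset
        double_coset_closed[of g h \<alpha> \<beta>])
  moreover have "g \<in> double_coset \<alpha> \<beta> g"
    unfolding mem_double_coset
    by (rule bexI[OF bexI[OF _ S_inf_id] S_inf_id]) simp
  ultimately show ?thesis unfolding coset_board_def by blast
qed

theorem bij_betw_coset_board:
  "bij_betw (coset_board \<alpha> \<beta>) (double_cosets \<alpha> \<beta>) (boards \<alpha> \<beta>)"
  unfolding bij_betw_def
proof
  show "inj_on (coset_board \<alpha> \<beta>) (double_cosets \<alpha> \<beta>)"
  proof (rule inj_onI)
    fix \<aa> \<bb> assume ab: "\<aa> \<in> double_cosets \<alpha> \<beta>" "\<bb> \<in> double_cosets \<alpha> \<beta>"
      and eq: "coset_board \<alpha> \<beta> \<aa> = coset_board \<alpha> \<beta> \<bb>"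
    obtain g h where g: "g \<in> carrier trisym" "\<aa> = double_coset \<alpha> \<beta> g"
      and h: "h \<in> carrier trisym" "\<bb> = double_coset \<alpha> \<beta> h"
      using ab by (auto simp: double_cosets_def)
    have "board_class \<alpha> \<beta> (board_of \<alpha> \<beta> g) = board_class \<alpha> \<beta> (board_of \<alpha> \<beta> h)"
      using eq g h by (simp add: coset_board_double_coset)
    then have "board_iso \<alpha> \<beta> (board_of \<alpha> \<beta> g) (board_of \<alpha> \<beta> h)"
      using is_board_board_of[OF h(1)] board_iso_refl unfolding board_class_def by blast
    then have "h \<in> double_coset \<alpha> \<beta> g"
      using g h by (intro double_coset_if_board_iso)
    then obtain s t where s: "s \<in> S_inf \<alpha>" and t: "t \<in> S_inf \<beta>" and h_eq: "h = (\<lambda>c. s \<circ> g c \<circ> t)"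
      by (auto simp: mem_double_coset)
    have g_eq: "g = (\<lambda>c. inv_into UNIV s \<circ> h c \<circ> inv_into UNIV t)"
    proof -
      have st: "s permutes {1..}" "t permutes {1..}" using s t by (simp_all add: S_inf_def)
      show ?thesis
        using permutes_inverses(2)[OF st(1)] permutes_inverses(1)[OF st(2)]
        by (simp add: h_eq fun_eq_iff)
    qed
    have 1: "double_coset \<alpha> \<beta> h \<subseteq> double_coset \<alpha> \<beta> g"
    proof
      fix k assume "k \<in> double_coset \<alpha> \<beta> h"
      then obtain u v where "u \<in> S_inf \<alpha>" "v \<in> S_inf \<beta>" "k = (\<lambda>c. u \<circ> h c \<circ> v)"
        by (auto simp: mem_double_coset)
      then show "k \<in> double_coset \<alpha> \<beta> g"
        unfolding mem_double_coset h_eq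
        by (intro bexI[of _ "u \<circ> s"] bexI[of _ "t \<circ> v"] S_inf_compose s t)
          (simp_all add: o_assoc)
    qed
    have 2: "double_coset \<alpha> \<beta> g \<subseteq> double_coset \<alpha> \<beta> h"
    proof
      fix k assume "k \<in> double_coset \<alpha> \<beta> g"
      then obtain u v where uv: "u \<in> S_inf \<alpha>" "v \<in> S_inf \<beta>" "k = (\<lambda>c. u \<circ> g c \<circ> v)"
        by (auto simp: mem_double_coset)
      moreover have "g c = inv_into UNIV s \<circ> h c \<circ> inv_into UNIV t" for c
        using g_eq by (rule fun_cong)
      ultimately have "k = (\<lambda>c. (u \<circ> inv_into UNIV s) \<circ> h c \<circ> (inv_into UNIV t \<circ> v))"
        by (simp add: o_assoc)
      then show "k \<in> double_coset \<alpha> \<beta> h"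
        unfolding mem_double_coset
        by (intro bexI[of _ "u \<circ> inv_into UNIV s"] bexI[of _ "inv_into UNIV t \<circ> v"]
            S_inf_compose S_inf_inv s t uv)
    qed
    show "\<aa> = \<bb>" using 1 2 g h by blast
  qed
  show "coset_board \<alpha> \<beta> ` double_cosets \<alpha> \<beta> = boards \<alpha> \<beta>"
  proof
    show "coset_board \<alpha> \<beta> ` double_cosets \<alpha> \<beta> \<subseteq> boards \<alpha> \<beta>"
      by (auto simp: double_cosets_def boards_def coset_board_double_coset is_board_board_of)
    show "boards \<alpha> \<beta> \<subseteq> coset_board \<alpha> \<beta> ` double_cosets \<alpha> \<beta>"
    proof
      fix \<AA> assume "\<AA> \<in> boards \<alpha> \<beta>"
      then obtain B :: "nat board" where B: "is_board \<alpha> \<beta> B" "\<AA> = board_class \<alpha> \<beta> B"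
        unfolding boards_def by blast
      obtain g where g: "g \<in> carrier trisym" "board_iso \<alpha> \<beta> (board_of \<alpha> \<beta> g) B"
        using ex_board_of_iso[OF B(1)] by blast
      then have "\<AA> = coset_board \<alpha> \<beta> (double_coset \<alpha> \<beta> g)"
        using B by (simp add: coset_board_double_coset board_class_eq is_board_board_of)
      then show "\<AA> \<in> coset_board \<alpha> \<beta> ` double_cosets \<alpha> \<beta>"
        using g by (auto simp: double_cosets_def)
    qed
  qed
qed


section \<open>Multiplication\<close>

text \<open>
  Gluing the hole left by the black triangle \<open>j\<close> of \<open>A\<close> to the hole left by the white triangle \<open>j\<close>
  of \<open>B\<close>: a black triangle of \<open>B\<close> that had the white triangle \<open>j\<close> across its \<open>c\<close>-edge becomes the
  \<open>c\<close>-neighbor of the white triangle of \<open>A\<close> that had the black triangle \<open>j\<close> across its \<open>c\<close>-edge.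
\<close>

definition glue :: "nat \<Rightarrow> 'a board \<Rightarrow> 'b board \<Rightarrow> ('a + 'b) board" where
  "glue \<beta> A B =
     \<lparr>black = (black A - black_label A ` {1..\<beta>}) <+> black B,
      white = white A <+> (white B - white_label B ` {1..\<beta>}),
      adj = (\<lambda>c. case_sum (\<lambda>x. Inl (adj A c x))
        (\<lambda>y. if adj B c y \<in> white_label B ` {1..\<beta>}
              then Inl (adj A c (black_label A (inv_into {1..\<beta>} (white_label B) (adj B c y))))
              else Inr (adj B c y))),
      black_label = (\<lambda>j. Inr (black_label B j)),
      white_label = (\<lambda>j. Inl (white_label A j))\<rparr>"

definition board_mult ::
  "nat \<Rightarrow> nat \<Rightarrow> nat \<Rightarrow> nat board set \<Rightarrow> nat board set \<Rightarrow> nat board set" where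
  "board_mult \<alpha> \<beta> \<gamma> \<AA> \<BB> =
     (\<Union>A\<in>\<AA>. \<Union>B\<in>\<BB>. board_class \<alpha> \<gamma> (delete_empty_chebureks \<alpha> \<gamma> (glue \<beta> A B)))"

definition coset_mult ::
  "nat \<Rightarrow> nat \<Rightarrow> nat \<Rightarrow> triple set \<Rightarrow> triple set \<Rightarrow> triple set" where
  "coset_mult \<alpha> \<beta> \<gamma> \<aa> \<bb> = inv_into (double_cosets \<alpha> \<gamma>) (coset_board \<alpha> \<gamma>)
     (board_mult \<alpha> \<beta> \<gamma> (coset_board \<alpha> \<beta> \<aa>) (coset_board \<beta> \<gamma> \<bb>))"

end

theory Submission
  imports Defs
begin

text \<open>
  Write \<open>\<aa> = K(\<alpha>) p K(\<beta>)\<close> and \<open>\<bb> = K(\<beta>) q K(\<gamma>)\<close>. If \<open>\<theta>\<close> fixes \<open>1, \<dots>, \<beta>\<close> and moves \<open>\<beta> + 1, \<dots>, M\<close> beyond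
  a large \<open>M\<close>, then the essential parts of \<open>p\<close> and \<open>q\<close> meet in \<open>p \<theta> q\<close> only along the first \<open>\<beta>\<close> numbers,
  so the board of \<open>p \<theta> q\<close> is \<open>\<aa> \<circ> \<bb>\<close>. All these \<open>\<theta>\<close> form one double coset of \<open>K(M)\<close>.

  Let \<open>v\<close> be fixed by \<open>K(\<gamma>)\<close>. As the three components of \<open>q\<close> agree almost everywhere, \<open>x = \<rho>(q) v\<close> is fixed
  by some \<open>K(M)\<close>; likewise \<open>\<rho>(p\<^sup>-\<^sup>1) w\<close> for \<open>w\<close> fixed by \<open>K(\<alpha>)\<close>. For \<open>\<theta>\<^sub>i\<close> moving \<open>\<beta> + 1, \<dots>, M\<close> to disjoint
  blocks, the vectors \<open>\<rho>(\<theta>\<^sub>i) x\<close> have constant pairwise inner products. Hence their averages converge,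
  the limit is the projection \<open>P(\<beta>) x\<close>, and its inner product with \<open>\<rho>(p\<^sup>-\<^sup>1) w\<close> is that of any single
  \<open>\<rho>(\<theta>\<^sub>i) x\<close>, i.e. \<open>\<rho>(p) P(\<beta>) \<rho>(q) v\<close> and \<open>\<rho>(p \<theta>\<^sub>i q) v\<close> have the same projection to the
  \<open>K(\<alpha>)\<close>-fixed vectors.
\<close>

section \<open>Averages of a sequence with constant inner products\<close>

text \<open>For \<open>n \<le> m\<close> the product of the averages \<open>A n\<close> and
  \<open>A m\<close> involves only the larger index, so their squared distance is
  \<open>(a - d) / (n + 1) - (a - d) / (m + 1)\<close> and the averages form a Cauchy sequence.
  Finitely many exceptional \<open>u j\<close> do not influence the limit, hence the eventual value
  is enough.\<close>

lemma exists_mean: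
  fixes u :: "nat \<Rightarrow> 'a::{real_inner,complete_space}"
  assumes d: "\<And>i j. i \<noteq> j \<Longrightarrow> u i \<bullet> u j = d" and a: "\<And>i. u i \<bullet> u i = a"
  shows "\<exists>z. \<forall>w c. eventually (\<lambda>j. u j \<bullet> w = c) sequentially \<longrightarrow> z \<bullet> w = c"
proof -
  define A where "A n = (1 / real (Suc n)) *\<^sub>R (\<Sum>i\<le>n. u i)" for n
  \<comment> \<open>The right side is \<open>2 * (a - d)\<close>; its sign later allows the
    subtracted term in \<open>dist\<close> to be dropped.\<close>
  have "0 \<le> (u 0 - u 1) \<bullet> (u 0 - u 1)" by simp
  then have ad: "d \<le> a" using d[of 0 1] d[of 1 0] by (simp add: inner_diff a algebra_simps)
  have uu: "u i \<bullet> u j = d + (if i = j then a - d else 0)" for i j by (simp add: a d)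
  have AA: "A n \<bullet> A m = d + (a - d) / real (Suc m)" if "n \<le> m" for n m
  proof -
    have "(\<Sum>i\<le>n. u i) \<bullet> (\<Sum>j\<le>m. u j) = (\<Sum>i\<le>n. \<Sum>j\<le>m. u i \<bullet> u j)"
      by (subst inner_sum_left, subst inner_sum_right) simp
    also have "\<dots> = (\<Sum>i\<le>n. real (Suc m) * d + (a - d))"
      unfolding uu using that by (intro sum.cong) (auto simp: sum.distrib)
    also have "\<dots> = real (Suc n) * (real (Suc m) * d + (a - d))" by simp
    finally have *: "(\<Sum>i\<le>n. u i) \<bullet> (\<Sum>j\<le>m. u j) = real (Suc n) * (real (Suc m) * d + (a - d))" .
    have "A n \<bullet> A m = 1 / real (Suc n) * (1 / real (Suc m) * ((\<Sum>i\<le>n. u i) \<bullet> (\<Sum>j\<le>m. u j)))"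
      by (simp add: A_def)
    also have "\<dots> = d + (a - d) / real (Suc m)"
      unfolding * by (simp add: field_simps del: of_nat_Suc)
    finally show ?thesis .
  qed
  have dist: "(norm (A n - A m))\<^sup>2 \<le> (a - d) / real (Suc n)" if "n \<le> m" for n m
  proof -
    have "(norm (A n - A m))\<^sup>2 = A n \<bullet> A n - 2 * (A n \<bullet> A m) + A m \<bullet> A m"
      by (simp add: power2_norm_eq_inner inner_diff inner_commute)
    also have "\<dots> = (a - d) / real (Suc n) - (a - d) / real (Suc m)"
      using AA[OF that] AA[of n n] AA[of m m] by simp
    also have "\<dots> \<le> (a - d) / real (Suc n)" using ad by simp
    finally show ?thesis .
  qed
  have "Cauchy A"
  proof (rule metric_CauchyI)
    fix e :: real assume e: "e > 0"
    have "(\<lambda>n. (a - d) / real (Suc n)) \<longlonglongrightarrow> 0"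
      by (rule LIMSEQ_Suc[OF lim_const_over_n])
    then have "eventually (\<lambda>n. (a - d) / real (Suc n) < e\<^sup>2) sequentially"
      using e by (intro order_tendstoD) auto
    then obtain N where N: "\<And>n. n \<ge> N \<Longrightarrow> (a - d) / real (Suc n) < e\<^sup>2"
      by (auto simp: eventually_sequentially)
    have "dist (A n) (A m) < e" if "n \<ge> N" "n \<le> m" for n m
      using dist[OF that(2)] N[OF that(1)] e
      by (intro power_less_imp_less_base[of _ 2 e]) (auto simp: dist_norm)
    then show "\<exists>M. \<forall>m\<ge>M. \<forall>n\<ge>M. dist (A m) (A n) < e"
      by (intro exI[of _ N]) (metis dist_commute nle_le)
  qed
  then obtain z where z: "A \<longlonglongrightarrow> z"
    using Cauchy_convergent convergent_def by blast
  show ?thesis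
  proof (intro exI allI impI)
    fix w c assume "eventually (\<lambda>j. u j \<bullet> w = c) sequentially"
    then obtain J where J: "\<And>j. j \<ge> J \<Longrightarrow> u j \<bullet> w = c" by (auto simp: eventually_sequentially)
    \<comment> \<open>The total deviation from \<open>c\<close>; terms beyond \<open>J\<close> add
      nothing to it, so the average deviates by \<open>S / (n + 1)\<close>.\<close>
    define S where "S = (\<Sum>i\<le>J. u i \<bullet> w - c)"
    have "A n \<bullet> w = c + S / real (Suc n)" if "n \<ge> J" for n
    proof -
      have "(\<Sum>i\<le>n. u i \<bullet> w - c) = S"
        unfolding S_def using that J by (intro sum.mono_neutral_right) auto
      then have "(\<Sum>i\<le>n. u i \<bullet> w) = real (Suc n) * c + S" by (simp add: sum_subtractf)
      then show ?thesis
        by (simp add: A_def inner_sum_left field_simps del: of_nat_Suc)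
    qed
    then have "eventually (\<lambda>n. A n \<bullet> w = c + S / real (Suc n)) sequentially"
      by (auto simp: eventually_sequentially)
    moreover have "(\<lambda>n. c + S / real (Suc n)) \<longlonglongrightarrow> c + 0"
      by (intro tendsto_intros LIMSEQ_Suc[OF lim_const_over_n])
    ultimately have "(\<lambda>n. A n \<bullet> w) \<longlonglongrightarrow> c"
      by (simp add: tendsto_cong)
    moreover have "(\<lambda>n. A n \<bullet> w) \<longlonglongrightarrow> z \<bullet> w"
      by (intro tendsto_intros z)
    ultimately show "z \<bullet> w = c" by (rule LIMSEQ_unique[rotated])
  qed
qed


section \<open>Generic permutations\<close>

definition generic :: "nat \<Rightarrow> nat \<Rightarrow> (nat \<Rightarrow> nat) set" where
  "generic \<beta> M = {\<theta> \<in> S_inf \<beta>. \<forall>b\<in>{\<beta><..M}. \<theta> b > M}"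

lemma S_inf_fixes:
  assumes "s \<in> S_inf \<alpha>" "i \<le> \<alpha>"
  shows "s i = i"
  using assms by (cases "i = 0") (auto simp: S_inf_def permutes_def)

lemma S_inf_inverses:
  assumes "s \<in> S_inf \<alpha>"
  shows "s (inv_into UNIV s i) = i" "inv_into UNIV s (s i) = i"
  using assms permutes_inverses by (auto simp: S_inf_def)

text \<open>Inverses of generic permutations are generic: a preimage in \<open>{\<beta><..M}\<close>
  would be sent beyond \<open>M\<close>.\<close>

lemma generic_inv:
  assumes \<theta>: "\<theta> \<in> generic \<beta> M" and i: "i \<in> {\<beta><..M}"
  shows "inv_into UNIV \<theta> i > M"
proof (rule ccontr)
  have \<theta>S: "\<theta> \<in> S_inf \<beta>" using \<theta> by (simp add: generic_def)
  let ?j = "inv_into UNIV \<theta> i"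
  assume "\<not> ?j > M"
  moreover have "?j > \<beta>" using S_inf_gt[OF S_inf_inv[OF \<theta>S], of i] i by simp
  ultimately have "\<theta> ?j > M" using \<theta> by (auto simp: generic_def)
  then show False using S_inf_inverses[OF \<theta>S] i by simp
qed

text \<open>For \<open>s\<close> to fix \<open>1, ..., M\<close>, \<open>t\<close> has to carry the
  preimage of each such \<open>i\<close> under \<open>\<theta>'\<close> to its preimage under
  \<open>\<theta>\<close>. For \<open>i \<le> \<beta>\<close> both preimages are \<open>i\<close>;
  for the other \<open>i\<close> both lie beyond \<open>M\<close>, so this does not conflict with
  \<open>t\<close> fixing \<open>1, ..., M\<close>. Only finitely many values are prescribed beyond
  \<open>M\<close>, and the infinite complements are matched arbitrarily.\<close>

lemma generic_double_coset:
  assumes \<theta>: "\<theta> \<in> generic \<beta> M" and \<theta>': "\<theta>' \<in> generic \<beta> M"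
  obtains s t where "s \<in> S_inf M" "t \<in> S_inf M" "\<theta>' = s \<circ> \<theta> \<circ> t"
proof -
  have S: "\<theta> \<in> S_inf \<beta>" "\<theta>' \<in> S_inf \<beta>" using assms by (simp_all add: generic_def)
  let ?i = "inv_into UNIV \<theta>" and ?i' = "inv_into UNIV \<theta>'"
  note inv = S_inf_inverses[OF S(1)] S_inf_inverses[OF S(2)]
  define D where "D = ?i ` {\<beta><..M}"
  define D' where "D' = ?i' ` {\<beta><..M}"
  have D: "D \<subseteq> {M<..}" "D' \<subseteq> {M<..}" "finite D" "finite D'"
    using generic_inv[OF \<theta>] generic_inv[OF \<theta>'] by (auto simp: D_def D'_def)
  have inf: "infinite ({M<..} - D)" "infinite ({M<..} - D')"
    using D by (simp_all add: infinite_Ioi)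
  obtain e where e: "bij_betw e ({M<..} - D') ({M<..} - D)"
  proof -
    have "bij_betw (from_nat_into ({M<..} - D) \<circ> to_nat_on ({M<..} - D')) ({M<..} - D') ({M<..} - D)"
      using inf by (intro bij_betw_trans[OF to_nat_on_infinite bij_betw_from_nat_into]) auto
    then show thesis by (rule that)
  qed
  define t where "t i = (if i \<in> D' then ?i (\<theta>' i) else if i \<le> M then i else e i)" for i
  have "bij_betw t (D' \<union> ({M<..} - D')) (D \<union> ({M<..} - D))"
  proof (rule bij_betw_combine)
    show "bij_betw t D' D"
    proof (rule bij_betw_byWitness[where f' = "\<lambda>i. ?i' (\<theta> i)"])
      show "\<forall>a\<in>D'. ?i' (\<theta> (t a)) = a" by (simp add: t_def inv)
      show "t ` D' \<subseteq> D" by (auto simp: t_def D_def D'_def inv)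
      show *: "(\<lambda>i. ?i' (\<theta> i)) ` D \<subseteq> D'" by (auto simp: D_def D'_def inv)
      show "\<forall>a\<in>D. t (?i' (\<theta> a)) = a" using * by (auto simp: t_def inv)
    qed
    show "bij_betw t ({M<..} - D') ({M<..} - D)"
      using e by (rule bij_betw_cong[THEN iffD1, rotated]) (auto simp: t_def)
  qed auto
  moreover have "D' \<union> ({M<..} - D') = {M<..}" "D \<union> ({M<..} - D) = {M<..}" using D by blast+
  ultimately have "bij_betw t {M<..} {M<..}" by metis
  then have tp: "t permutes {M<..}"
    by (rule bij_imp_permutes) (use D in \<open>auto simp: t_def\<close>)
  then have "t permutes {1..}" by (rule permutes_subset) auto
  then have t: "t \<in> S_inf M" using tp by (auto simp: S_inf_def permutes_def)
  define s where "s = \<theta>' \<circ> inv_into UNIV t \<circ> ?i"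
  note tinv = S_inf_inverses[OF t]
  have "s \<in> S_inf 0"
    unfolding s_def using S_inf_antimono[of 0] S t
    by (intro S_inf_compose S_inf_inv) auto
  moreover have "s i = i" if i: "i \<in> {1..M}" for i
  proof (cases "i \<le> \<beta>")
    case True
    then have "?i i = i" "inv_into UNIV t i = i" "\<theta>' i = i"
      using S_inf_fixes[OF S_inf_inv[OF S(1)]] S_inf_fixes[OF S(2)] S_inf_fixes[OF S_inf_inv[OF t]] i
      by auto
    then show ?thesis by (simp add: s_def)
  next
    case False
    then have "?i' i \<in> D'" using i by (auto simp: D'_def)
    then have "t (?i' i) = ?i i" by (simp add: t_def inv)
    then have "inv_into UNIV t (?i i) = ?i' i" by (metis tinv(2))
    then show ?thesis by (simp add: s_def inv)
  qed
  ultimately have "s \<in> S_inf M" by (auto simp: S_inf_def)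
  moreover have "\<theta>' = s \<circ> \<theta> \<circ> t" by (simp add: s_def fun_eq_iff inv tinv)
  ultimately show thesis using t that by blast
qed

text \<open>The shift is a positive multiple of \<open>M\<close>, which puts the translated interval
  beyond \<open>M\<close> and makes the translates for different \<open>i\<close> disjoint. Being an
  involution, the swap is its own inverse, which simplifies adjoints later.\<close>

definition block_swap :: "nat \<Rightarrow> nat \<Rightarrow> nat \<Rightarrow> nat \<Rightarrow> nat" where
  "block_swap \<beta> M i x =
     (if x \<in> {\<beta><..M} then x + Suc i * M
      else if x \<in> {\<beta> + Suc i * M<..M + Suc i * M} then x - Suc i * M else x)"

lemma block_swap_involution: "block_swap \<beta> M i (block_swap \<beta> M i x) = x"
  by (auto simp: block_swap_def)

lemma inv_block_swap: "inv_into UNIV (block_swap \<beta> M i) = block_swap \<beta> M i"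
  by (rule inv_unique_comp) (auto simp: block_swap_involution fun_eq_iff)

lemma block_swap_S_inf:
  assumes "\<beta> \<le> M"
  shows "block_swap \<beta> M i \<in> S_inf \<beta>"
proof -
  have "bij_betw (block_swap \<beta> M i) {1..} {1..}"
    by (rule bij_betw_byWitness[where f' = "block_swap \<beta> M i"])
      (auto simp: block_swap_involution, auto simp: block_swap_def)
  then have "block_swap \<beta> M i permutes {1..}"
    by (rule bij_imp_permutes) (auto simp: block_swap_def)
  then show ?thesis using assms by (auto simp: S_inf_def block_swap_def)
qed

text \<open>Among the numbers above \<beta>, only those in the \<open>i\<close>-th translate are
  sent back to at most \<open>M\<close>.\<close>

lemma block_swap_comp_generic:
  assumes "\<beta> \<le> M" and \<tau>: "\<tau> \<in> S_inf \<beta>"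
    and "\<And>b. b \<in> {\<beta><..M} \<Longrightarrow> \<tau> b \<notin> {\<beta> + Suc i * M<..M + Suc i * M}"
  shows "block_swap \<beta> M i \<circ> \<tau> \<in> generic \<beta> M"
proof -
  have "block_swap \<beta> M i (\<tau> b) > M" if b: "b \<in> {\<beta><..M}" for b
  proof -
    have "\<tau> b > \<beta>" using S_inf_gt[OF \<tau>] b by auto
    then show ?thesis using assms(3)[OF b] b by (auto simp: block_swap_def)
  qed
  then show ?thesis
    using S_inf_compose[OF block_swap_S_inf[OF assms(1)] \<tau>] by (simp add: generic_def)
qed

lemma block_swap_generic:
  assumes "\<beta> \<le> M"
  shows "block_swap \<beta> M i \<in> generic \<beta> M"
  using block_swap_comp_generic[OF assms S_inf_id, of i] by auto

text \<open>The \<open>i\<close>-th and \<open>j\<close>-th translates are disjoint. This yields the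
  constant pairwise inner products required by \<open>exists_mean\<close>.\<close>

lemma block_swap_block_swap_generic:
  assumes "\<beta> \<le> M" "i \<noteq> j"
  shows "block_swap \<beta> M j \<circ> block_swap \<beta> M i \<in> generic \<beta> M"
proof (rule block_swap_comp_generic[OF assms(1) block_swap_S_inf[OF assms(1)]])
  fix b assume b: "b \<in> {\<beta><..M}"
  have "Suc i * M + M \<le> Suc j * M \<or> Suc j * M + M \<le> Suc i * M"
  proof (cases "i < j")
    case True
    then have "Suc (Suc i) * M \<le> Suc j * M" by (intro mult_le_mono1) simp
    then show ?thesis by simp
  next
    case False
    then have "Suc (Suc j) * M \<le> Suc i * M" using assms(2) by (intro mult_le_mono1) simp
    then show ?thesis by simp
  qed
  then show "block_swap \<beta> M i b \<notin> {\<beta> + Suc j * M<..M + Suc j * M}"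
    using b assms(1) by (auto simp: block_swap_def)
qed

lemma eventually_block_swap_generic:
  assumes "\<beta> \<le> M" and \<tau>: "\<tau> \<in> S_inf \<beta>"
  shows "eventually (\<lambda>j. block_swap \<beta> M j \<circ> \<tau> \<in> generic \<beta> M) sequentially"
proof -
  \<comment> \<open>Translates far enough out miss the finite image of the interval. The inserted 0
    keeps the set nonempty when \<open>\<beta> = M\<close>.\<close>
  define J where "J = Max (insert 0 (\<tau> ` {\<beta><..M}))"
  have "block_swap \<beta> M j \<circ> \<tau> \<in> generic \<beta> M" if j: "j \<ge> J" for j
  proof (rule block_swap_comp_generic[OF assms])
    fix b assume b: "b \<in> {\<beta><..M}"
    have "\<tau> b \<le> J" unfolding J_def using b by (intro Max_ge) auto
    moreover have "j \<le> Suc j * M" using b by (cases M) auto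
    ultimately show "\<tau> b \<notin> {\<beta> + Suc j * M<..M + Suc j * M}" using j by auto
  qed
  then show ?thesis by (auto simp: eventually_sequentially)
qed


section \<open>Gluing boards\<close>

text \<open>
  Infinitely many triangles and empty chebureks are allowed, so that glued boards and the triangles
  of a group element qualify before deletion.
\<close>

definition preboard :: "nat \<Rightarrow> nat \<Rightarrow> 'a board \<Rightarrow> bool" where
  "preboard \<alpha> \<beta> B \<longleftrightarrow>
     (\<forall>c. bij_betw (adj B c) (black B) (white B)) \<and>
     inj_on (black_label B) {1..\<beta>} \<and> black_label B ` {1..\<beta>} \<subseteq> black B \<and>
     inj_on (white_label B) {1..\<alpha>} \<and> white_label B ` {1..\<alpha>} \<subseteq> white B"

lemma is_board_imp_preboard: "is_board \<alpha> \<beta> B \<Longrightarrow> preboard \<alpha> \<beta> B"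
  by (simp add: is_board_def preboard_def)

lemma adj_empty_cheburek: "x \<in> empty_chebureks \<alpha> \<beta> B \<Longrightarrow> adj B c x = adj B d x"
  by (auto simp: empty_chebureks_def)

text \<open>On empty chebureks the three adjacency maps agree, so removing the red neighbors removes
  the neighbors of every color, and each adjacency restricts to a bijection. Labels survive because
  empty chebureks carry none.\<close>

lemma is_board_delete_empty_chebureks:
  assumes B: "preboard \<alpha> \<beta> B" and fin: "finite (black B)" "finite (white B)"
  shows "is_board \<alpha> \<beta> (delete_empty_chebureks \<alpha> \<beta> B)"
proof -
  let ?E = "empty_chebureks \<alpha> \<beta> B" and ?D = "delete_empty_chebureks \<alpha> \<beta> B"
  have adj: "bij_betw (adj B c) (black B) (white B)" for c using B by (simp add: preboard_def)
  have E: "?E \<subseteq> black B" by (auto simp: empty_chebureks_def)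
  have "bij_betw (adj B c) (black B - ?E) (white B - adj B Red ` ?E)" for c
  proof (rule bij_betw_imageI)
    show "inj_on (adj B c) (black B - ?E)"
      using adj[of c] by (auto simp: bij_betw_def inj_on_diff)
    have "adj B c ` (black B - ?E) = adj B c ` black B - adj B c ` ?E"
      using adj[of c] E by (intro inj_on_image_set_diff[of _ "black B"]) (auto simp: bij_betw_def)
    moreover have "adj B c ` ?E = adj B Red ` ?E"
      by (intro image_cong adj_empty_cheburek) auto
    ultimately show "adj B c ` (black B - ?E) = white B - adj B Red ` ?E"
      using adj[of c] by (simp add: bij_betw_def)
  qed
  moreover have "empty_chebureks \<alpha> \<beta> ?D = {}"
    by (auto simp: empty_chebureks_def delete_empty_chebureks_def)
  moreover have "black_label B ` {1..\<beta>} \<inter> ?E = {}" "white_label B ` {1..\<alpha>} \<inter> adj B Red ` ?E = {}"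
    by (auto simp: empty_chebureks_def)
  ultimately show ?thesis
    using B fin unfolding is_board_def preboard_def
    by (auto simp: delete_empty_chebureks_def)
qed

lemma image_Collect_mem:
  assumes "W \<subseteq> f ` X"
  shows "f ` {x \<in> X. f x \<in> W} = W" "f ` (X - {x \<in> X. f x \<in> W}) = f ` X - W"
  using assms by blast+

lemma bij_betw_image_image:
  assumes "bij_betw h X Y" "inj j" "\<And>x. x \<in> X \<Longrightarrow> f (i x) = j (h x)"
  shows "bij_betw f (i ` X) (j ` Y)"
proof (rule bij_betw_imageI)
  show "inj_on f (i ` X)"
    using assms by (auto intro!: inj_onI simp: inj_eq bij_betw_def dest: inj_onD)
  have "f ` i ` X = j ` h ` X"
    unfolding image_image using assms(3) by (intro image_cong) auto
  then show "f ` i ` X = j ` Y" using assms(1) by (simp add: bij_betw_def)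
qed

text \<open>For each color the new adjacency is assembled from three bijections with disjoint
  sources and targets: edges inside \<open>A\<close>, edges across the seam from \<open>B\<close> to
  \<open>A\<close>, and edges inside \<open>B\<close>.\<close>

lemma preboard_glue:
  assumes A: "preboard \<alpha> \<beta> A" and B: "preboard \<beta> \<gamma> B"
  shows "preboard \<alpha> \<gamma> (glue \<beta> A B)"
proof -
  have bl: "inj_on (black_label A) {1..\<beta>}" "black_label A ` {1..\<beta>} \<subseteq> black A"
    and wl: "inj_on (white_label B) {1..\<beta>}" "white_label B ` {1..\<beta>} \<subseteq> white B"
    using A B by (simp_all add: preboard_def)
  let ?L = "black_label A ` {1..\<beta>}" and ?W = "white_label B ` {1..\<beta>}"
  have "bij_betw (adj (glue \<beta> A B) c) (black (glue \<beta> A B)) (white (glue \<beta> A B))" for c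
  proof -
    have adj: "bij_betw (adj A c) (black A) (white A)" "bij_betw (adj B c) (black B) (white B)"
      using A B by (simp_all add: preboard_def)
    let ?f = "adj (glue \<beta> A B) c" and ?i = "inv_into {1..\<beta>} (white_label B)"
    \<comment> \<open>The black triangles of \<open>B\<close> that border a hole along their
      \<open>c\<close>-edge; this set depends on the color.\<close>
    let ?V = "{y \<in> black B. adj B c y \<in> ?W}"
    have inj: "inj_on (adj B c) (black B)" and im: "adj B c ` black B = white B"
      using adj(2) by (simp_all add: bij_betw_def)
    have "?W \<subseteq> adj B c ` black B" using wl(2) im by simp
    then have "adj B c ` ?V = ?W" "adj B c ` (black B - ?V) = white B - ?W"
      using image_Collect_mem[of ?W "adj B c"] by (simp_all only: im)
    with inj_on_subset[OF inj, of ?V] inj_on_diff[OF inj, of ?V]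
    have V: "bij_betw (adj B c) ?V ?W" and V': "bij_betw (adj B c) (black B - ?V) (white B - ?W)"
      unfolding bij_betw_def by blast+
    have 1: "bij_betw ?f (Inl ` (black A - ?L)) (Inl ` adj A c ` (black A - ?L))"
    proof (rule bij_betw_image_image)
      show "bij_betw (adj A c) (black A - ?L) (adj A c ` (black A - ?L))"
        using adj(1) by (simp add: bij_betw_def inj_on_diff)
    qed (simp_all add: glue_def)
    have 2: "bij_betw ?f (Inr ` ?V) (Inl ` adj A c ` ?L)"
    proof -
      have "bij_betw (\<lambda>y. adj A c (black_label A (?i (adj B c y)))) ?V (adj A c ` ?L)"
      proof -
        have "bij_betw (adj A c \<circ> (black_label A \<circ> (?i \<circ> adj B c))) ?V (adj A c ` ?L)"
        proof (intro bij_betw_trans[OF bij_betw_trans[OF bij_betw_trans[OF V]]])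
          show "bij_betw ?i ?W {1..\<beta>}"
            using wl(1) by (intro bij_betw_inv_into) (auto simp: bij_betw_def)
          show "bij_betw (black_label A) {1..\<beta>} ?L" using bl by (simp add: bij_betw_def)
          show "bij_betw (adj A c) ?L (adj A c ` ?L)"
            using adj(1) bl(2) by (auto simp: bij_betw_def intro: inj_on_subset)
        qed
        then show ?thesis by (simp add: o_def)
      qed
      then show ?thesis by (rule bij_betw_image_image) (simp_all add: glue_def)
    qed
    have 3: "bij_betw ?f (Inr ` (black B - ?V)) (Inr ` (white B - ?W))"
      using V' by (rule bij_betw_image_image) (auto simp: glue_def)
    have "adj A c ` ?L \<inter> adj A c ` (black A - ?L) = {}"
      using adj(1) bl(2) by (auto simp: bij_betw_def inj_on_def)
    then have *: "Inl ` adj A c ` (black A - ?L) \<inter> (Inl ` adj A c ` ?L \<union> Inr ` (white B - ?W)) = {}"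
      by blast
    have whiteA: "adj A c ` (black A - ?L) \<union> adj A c ` ?L = white A"
      using bij_betw_imp_surj_on[OF adj(1)] bl(2) by blast
    have "bij_betw ?f (Inl ` (black A - ?L) \<union> (Inr ` ?V \<union> Inr ` (black B - ?V)))
       (Inl ` adj A c ` (black A - ?L) \<union> (Inl ` adj A c ` ?L \<union> Inr ` (white B - ?W)))"
      by (intro bij_betw_combine 1 2 3 *) blast
    moreover have "Inl ` adj A c ` (black A - ?L) \<union> (Inl ` adj A c ` ?L \<union> Inr ` (white B - ?W))
       = white (glue \<beta> A B)"
      by (simp only: glue_def Plus_def board.simps image_Un Un_assoc flip: whiteA)
    moreover have "Inl ` (black A - ?L) \<union> (Inr ` ?V \<union> Inr ` (black B - ?V)) = black (glue \<beta> A B)"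
      by (auto simp: glue_def Plus_def)
    ultimately show ?thesis by (simp only:)
  qed
  moreover have "inj_on (black_label (glue \<beta> A B)) {1..\<gamma>}"
    "black_label (glue \<beta> A B) ` {1..\<gamma>} \<subseteq> black (glue \<beta> A B)"
    using B comp_inj_on[of "black_label B" "{1..\<gamma>}" Inr]
    by (auto simp: preboard_def glue_def o_def)
  moreover have "inj_on (white_label (glue \<beta> A B)) {1..\<alpha>}"
    "white_label (glue \<beta> A B) ` {1..\<alpha>} \<subseteq> white (glue \<beta> A B)"
    using A comp_inj_on[of "white_label A" "{1..\<alpha>}" Inl]
    by (auto simp: preboard_def glue_def o_def)
  ultimately show ?thesis by (simp add: preboard_def)
qed

lemma finite_glue:
  assumes "is_board \<alpha> \<beta> A" "is_board \<beta> \<gamma> B"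
  shows "finite (black (glue \<beta> A B))" "finite (white (glue \<beta> A B))"
  using assms by (auto simp: is_board_def glue_def)

text \<open>The maps need only be embeddings, so that a finite glued board can be compared with the
  infinite triangulation of a group element. Checking the leftover black triangles suffices, since
  the surviving white triangles are exactly the red neighbors of the surviving black ones.\<close>

lemma board_iso_delete_empty_chebureks:
  assumes A: "preboard \<alpha> \<beta> A" and B: "preboard \<alpha> \<beta> B"
    and \<phi>: "inj_on \<phi> (black A)" "\<phi> ` black A \<subseteq> black B"
    and \<psi>: "inj_on \<psi> (white A)" "\<psi> ` white A \<subseteq> white B"
    and adj: "\<And>c x. x \<in> black A \<Longrightarrow> adj B c (\<phi> x) = \<psi> (adj A c x)"
    and bl: "\<And>j. j \<in> {1..\<beta>} \<Longrightarrow> \<phi> (black_label A j) = black_label B j"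
    and wl: "\<And>j. j \<in> {1..\<alpha>} \<Longrightarrow> \<psi> (white_label A j) = white_label B j"
    and rest: "black B - \<phi> ` black A \<subseteq> empty_chebureks \<alpha> \<beta> B"
  shows "board_iso \<alpha> \<beta> (delete_empty_chebureks \<alpha> \<beta> A) (delete_empty_chebureks \<alpha> \<beta> B)"
proof -
  let ?E = "empty_chebureks \<alpha> \<beta> A" and ?F = "empty_chebureks \<alpha> \<beta> B"
  have bijA: "bij_betw (adj A c) (black A) (white A)"
    and bijB: "bij_betw (adj B c) (black B) (white B)" for c
    using A B by (simp_all add: preboard_def)
  have adjA: "adj A c x \<in> white A" if "x \<in> black A" for c x
    using bijA[of c] that by (auto simp: bij_betw_def)
  have lA: "black_label A ` {1..\<beta>} \<subseteq> black A" "white_label A ` {1..\<alpha>} \<subseteq> white A"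
    using A by (simp_all add: preboard_def)
  \<comment> \<open>Injectivity of \<phi> and \<psi> reflects both the labels and the coincidence of
    the three neighbors.\<close>
  have E: "\<phi> x \<in> ?F \<longleftrightarrow> x \<in> ?E" if x: "x \<in> black A" for x
  proof -
    have "\<phi> x \<in> black_label B ` {1..\<beta>} \<longleftrightarrow> x \<in> black_label A ` {1..\<beta>}"
    proof
      assume "\<phi> x \<in> black_label B ` {1..\<beta>}"
      then obtain j where j: "j \<in> {1..\<beta>}" "\<phi> x = \<phi> (black_label A j)" using bl by force
      moreover have "black_label A j \<in> black A" using lA(1) j(1) by blast
      ultimately show "x \<in> black_label A ` {1..\<beta>}" using inj_onD[OF \<phi>(1)] x by blast
    qed (use bl in force)
    moreover have "\<psi> w \<in> white_label B ` {1..\<alpha>} \<longleftrightarrow> w \<in> white_label A ` {1..\<alpha>}"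
      if w: "w \<in> white A" for w
    proof
      assume "\<psi> w \<in> white_label B ` {1..\<alpha>}"
      then obtain j where j: "j \<in> {1..\<alpha>}" "\<psi> w = \<psi> (white_label A j)" using wl by force
      moreover have "white_label A j \<in> white A" using lA(2) j(1) by blast
      ultimately show "w \<in> white_label A ` {1..\<alpha>}" using inj_onD[OF \<psi>(1)] w by blast
    qed (use wl in force)
    moreover have "\<psi> (adj A c x) = \<psi> (adj A d x) \<longleftrightarrow> adj A c x = adj A d x" for c d
      using inj_on_eq_iff[OF \<psi>(1)] adjA[OF x] by blast
    moreover have "\<phi> x \<in> black B" using \<phi>(2) x by blast
    ultimately show ?thesis
      using x adjA[OF x] unfolding empty_chebureks_def mem_Collect_eq adj[OF x] by metis
  qed
  have 1: "bij_betw \<phi> (black A - ?E) (black B - ?F)"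
  proof (rule bij_betw_imageI)
    show "inj_on \<phi> (black A - ?E)" using \<phi>(1) by (simp add: inj_on_diff)
    show "\<phi> ` (black A - ?E) = black B - ?F"
      using E \<phi>(2) rest by blast
  qed
  have 2: "bij_betw \<psi> (white A - adj A Red ` ?E) (white B - adj B Red ` ?F)"
  proof (rule bij_betw_imageI)
    show "inj_on \<psi> (white A - adj A Red ` ?E)" using \<psi>(1) by (simp add: inj_on_diff)
    have EA: "?E \<subseteq> black A" and FB: "?F \<subseteq> black B" by (auto simp: empty_chebureks_def)
    have "adj A Red ` (black A - ?E) = adj A Red ` black A - adj A Red ` ?E"
      using bijA[of Red] EA by (intro inj_on_image_set_diff[of _ "black A"]) (auto simp: bij_betw_def)
    moreover have "adj B Red ` (black B - ?F) = adj B Red ` black B - adj B Red ` ?F"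
      using bijB[of Red] FB by (intro inj_on_image_set_diff[of _ "black B"]) (auto simp: bij_betw_def)
    ultimately have "white A - adj A Red ` ?E = adj A Red ` (black A - ?E)"
      "white B - adj B Red ` ?F = adj B Red ` (black B - ?F)"
      using bijA[of Red] bijB[of Red] by (simp_all add: bij_betw_def)
    moreover have "\<psi> ` adj A Red ` (black A - ?E) = adj B Red ` \<phi> ` (black A - ?E)"
      by (force simp: image_image adj intro: image_cong)
    moreover have "\<phi> ` (black A - ?E) = black B - ?F" using 1 by (simp add: bij_betw_def)
    ultimately show "\<psi> ` (white A - adj A Red ` ?E) = white B - adj B Red ` ?F" by simp
  qed
  show ?thesis
    unfolding board_iso_def
    using 1 2 adj bl wl
    by (intro exI[of _ \<phi>] exI[of _ \<psi>]) (simp add: delete_empty_chebureks_def)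
qed

section \<open>Independence of the glued board from the choice of representatives\<close>

lemma map_sum_image_Plus: "map_sum f g ` (X <+> Y) = f ` X <+> g ` Y"
  by (auto simp: Plus_def image_Un image_image)

lemma inj_on_map_sum: "inj_on f X \<Longrightarrow> inj_on g Y \<Longrightarrow> inj_on (map_sum f g) (X <+> Y)"
  by (rule inj_onI) (auto dest: inj_onD)

lemma board_iso_glue:
  assumes A: "is_board \<alpha> \<beta> A" and B: "is_board \<beta> \<gamma> B"
    and A': "is_board \<alpha> \<beta> A'" and B': "is_board \<beta> \<gamma> B'"
    and "board_iso \<alpha> \<beta> A A'" and "board_iso \<beta> \<gamma> B B'"
  shows "board_iso \<alpha> \<gamma> (delete_empty_chebureks \<alpha> \<gamma> (glue \<beta> A B))
           (delete_empty_chebureks \<alpha> \<gamma> (glue \<beta> A' B'))"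
proof -
  obtain \<phi> \<psi> where 1: "bij_betw \<phi> (black A) (black A')" "bij_betw \<psi> (white A) (white A')"
    "\<And>c x. x \<in> black A \<Longrightarrow> adj A' c (\<phi> x) = \<psi> (adj A c x)"
    "\<And>j. j \<in> {1..\<beta>} \<Longrightarrow> \<phi> (black_label A j) = black_label A' j"
    "\<And>j. j \<in> {1..\<alpha>} \<Longrightarrow> \<psi> (white_label A j) = white_label A' j"
    using assms(5) by (auto simp: board_iso_def)
  obtain \<phi>' \<psi>' where 2: "bij_betw \<phi>' (black B) (black B')" "bij_betw \<psi>' (white B) (white B')"
    "\<And>c x. x \<in> black B \<Longrightarrow> adj B' c (\<phi>' x) = \<psi>' (adj B c x)"
    "\<And>j. j \<in> {1..\<gamma>} \<Longrightarrow> \<phi>' (black_label B j) = black_label B' j"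
    "\<And>j. j \<in> {1..\<beta>} \<Longrightarrow> \<psi>' (white_label B j) = white_label B' j"
    using assms(6) by (auto simp: board_iso_def)
  note pb = assms(1-4)[THEN is_board_imp_preboard]
  have blA: "black_label A ` {1..\<beta>} \<subseteq> black A" "inj_on (black_label A) {1..\<beta>}"
    and wlB: "white_label B ` {1..\<beta>} \<subseteq> white B" "inj_on (white_label B) {1..\<beta>}"
    "inj_on (white_label B') {1..\<beta>}"
    using pb by (simp_all add: preboard_def)
  have imL: "\<phi> ` black_label A ` {1..\<beta>} = black_label A' ` {1..\<beta>}"
    unfolding image_image using 1(4) by (intro image_cong) auto
  have imW: "\<psi>' ` white_label B ` {1..\<beta>} = white_label B' ` {1..\<beta>}"
    unfolding image_image using 2(5) by (intro image_cong) auto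
  have bL: "\<phi> ` (black A - black_label A ` {1..\<beta>}) = black A' - black_label A' ` {1..\<beta>}"
    using 1(1) blA imL inj_on_image_set_diff[of \<phi> "black A" "black A" "black_label A ` {1..\<beta>}"]
    by (simp add: bij_betw_def)
  have wW: "\<psi>' ` (white B - white_label B ` {1..\<beta>}) = white B' - white_label B' ` {1..\<beta>}"
    using 2(2) wlB imW inj_on_image_set_diff[of \<psi>' "white B" "white B" "white_label B ` {1..\<beta>}"]
    by (simp add: bij_betw_def)
  have mem: "\<psi>' w \<in> white_label B' ` {1..\<beta>} \<longleftrightarrow> w \<in> white_label B ` {1..\<beta>}" if "w \<in> white B" for w
    using 2(2) that wlB(1) unfolding imW[symmetric]
    by (intro inj_on_image_mem_iff[of \<psi>' "white B"]) (auto simp: bij_betw_def)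
  have adjB: "adj B c y \<in> white B" if "y \<in> black B" for c y
    using pb(2) that by (auto simp: preboard_def bij_betw_def)
  let ?\<phi> = "map_sum \<phi> \<phi>'" and ?\<psi> = "map_sum \<psi> \<psi>'"
  have im: "?\<phi> ` black (glue \<beta> A B) = black (glue \<beta> A' B')"
    using bij_betw_imp_surj_on[OF 2(1)] by (simp only: glue_def board.simps map_sum_image_Plus bL)
  show ?thesis
  proof (rule board_iso_delete_empty_chebureks[of _ _ _ _ ?\<phi> ?\<psi>])
    show "preboard \<alpha> \<gamma> (glue \<beta> A B)" "preboard \<alpha> \<gamma> (glue \<beta> A' B')"
      by (rule preboard_glue[OF pb(1,2)], rule preboard_glue[OF pb(3,4)])
    show "inj_on ?\<phi> (black (glue \<beta> A B))" "inj_on ?\<psi> (white (glue \<beta> A B))"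
      unfolding glue_def board.simps
      by (intro inj_on_map_sum inj_on_diff bij_betw_imp_inj_on[OF 1(1)] bij_betw_imp_inj_on[OF 1(2)]
          bij_betw_imp_inj_on[OF 2(1)] bij_betw_imp_inj_on[OF 2(2)])+
    show "?\<phi> ` black (glue \<beta> A B) \<subseteq> black (glue \<beta> A' B')" using im by simp
    show "black (glue \<beta> A' B') - ?\<phi> ` black (glue \<beta> A B) \<subseteq> empty_chebureks \<alpha> \<gamma> (glue \<beta> A' B')"
      using im by simp
    show "?\<psi> ` white (glue \<beta> A B) \<subseteq> white (glue \<beta> A' B')"
      using bij_betw_imp_surj_on[OF 1(2)]
      by (simp only: glue_def board.simps map_sum_image_Plus wW order_refl)
    show "adj (glue \<beta> A' B') c (?\<phi> x) = ?\<psi> (adj (glue \<beta> A B) c x)"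
      if x: "x \<in> black (glue \<beta> A B)" for c x
    proof (cases x)
      case (Inl a)
      then show ?thesis using x 1(3) by (auto simp: glue_def)
    next
      case (Inr y)
      then have y: "y \<in> black B" using x by (auto simp: glue_def)
      show ?thesis
      proof (cases "adj B c y \<in> white_label B ` {1..\<beta>}")
        case True
        \<comment> \<open>Across the seam, the isomorphism of \<open>B\<close> preserves the label
          \<open>j\<close>, and that of \<open>A\<close> then transports the neighbor of the black
          triangle \<open>j\<close>.\<close>
        then obtain j where j: "j \<in> {1..\<beta>}" "adj B c y = white_label B j" by blast
        then have "inv_into {1..\<beta>} (white_label B) (adj B c y) = j"
          "inv_into {1..\<beta>} (white_label B') (\<psi>' (adj B c y)) = j"
          using wlB(2,3) 2(5) by (simp_all add: inv_into_f_f)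
        moreover have "black_label A j \<in> black A" using blA(1) j by blast
        then have "adj A' c (black_label A' j) = \<psi> (adj A c (black_label A j))"
          using 1(3,4) j by metis
        moreover have "\<psi>' (adj B c y) \<in> white_label B' ` {1..\<beta>}"
          using True mem[OF adjB[OF y]] by blast
        ultimately show ?thesis
          using Inr True 2(3)[OF y] by (simp add: glue_def del: One_nat_def)
      next
        case False
        then show ?thesis using Inr mem[OF adjB[OF y]] 2(3)[OF y] by (simp add: glue_def)
      qed
    qed
    show "?\<phi> (black_label (glue \<beta> A B) j) = black_label (glue \<beta> A' B') j" if "j \<in> {1..\<gamma>}" for j
      using that 2(4) by (simp add: glue_def)
    show "?\<psi> (white_label (glue \<beta> A B) j) = white_label (glue \<beta> A' B') j" if "j \<in> {1..\<alpha>}" for j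
      using that 1(5) by (simp add: glue_def)
  qed
qed

section \<open>The glued board as the board of a generic product\<close>

lemma preboard_triple:
  assumes "g \<in> carrier trisym"
  shows "preboard \<alpha> \<beta>
    \<lparr>black = {1..}, white = {1..}, adj = g, black_label = id, white_label = id\<rparr>"
  using assms by (auto simp: preboard_def carrier_trisym_iff intro: permutes_imp_bij)

lemma mem_K: "s \<in> S_inf \<alpha> \<Longrightarrow> (\<lambda>c. s) \<in> K \<alpha>"
  by (auto simp: K_def)

lemma const_carrier: "s \<in> S_inf \<alpha> \<Longrightarrow> (\<lambda>c. s) \<in> carrier trisym"
  using mem_K K_subset by blast

lemma comp_carrier:
  assumes "g \<in> carrier trisym" "h \<in> carrier trisym"
  shows "(\<lambda>c. g c \<circ> h c) \<in> carrier trisym"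
  using monoid.m_closed[OF group.is_monoid[OF group_trisym] assms] by simp

text \<open>
  The black triangle \<open>x\<close> of \<open>p\<close> corresponds to the triangle of \<open>p \<theta> q\<close> that \<open>\<theta> q\<close> sends to \<open>x\<close>. This
  is unambiguous, since \<open>\<theta>\<close> moves \<open>x\<close> into the range where the three components of \<open>q\<close> agree.
\<close>

lemma board_iso_generic:
  assumes p: "p \<in> carrier trisym" and q: "q \<in> carrier trisym"
    and \<theta>: "\<theta> \<in> generic \<beta> M"
    and Mp: "black (board_of \<alpha> \<beta> p) \<subseteq> {..M}" and Mq: "white (board_of \<beta> \<gamma> q) \<subseteq> {..M}"
  shows "board_iso \<alpha> \<gamma>
    (delete_empty_chebureks \<alpha> \<gamma> (glue \<beta> (board_of \<alpha> \<beta> p) (board_of \<beta> \<gamma> q)))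
    (board_of \<alpha> \<gamma> (\<lambda>c. p c \<circ> \<theta> \<circ> q c))"
proof -
  let ?r = "\<lambda>c. p c \<circ> \<theta> \<circ> q c"
  let ?E = "cheb \<alpha> \<beta> p" and ?F = "cheb \<beta> \<gamma> q"
  let ?A = "board_of \<alpha> \<beta> p" and ?B = "board_of \<beta> \<gamma> q"
  let ?R = "\<lparr>black = {1..}, white = {1..}, adj = ?r, black_label = id, white_label = id\<rparr> :: nat board"
  let ?i = "inv_into UNIV \<theta>" and ?qi = "inv_into UNIV (q Red)"
  note bA = board_of_simps[OF p, of \<alpha> \<beta>] and bB = board_of_simps[OF q, of \<beta> \<gamma>]
  have \<theta>S: "\<theta> \<in> S_inf \<beta>" using \<theta> by (simp add: generic_def)
  note \<theta>inv = S_inf_inverses[OF \<theta>S]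
  have r: "?r \<in> carrier trisym"
    using comp_carrier[OF comp_carrier[OF p const_carrier[OF \<theta>S]] q] by simp
  have perm: "p c permutes {1..}" "q c permutes {1..}" for c
    using p q by (simp_all add: carrier_trisym_iff)
  have \<theta>perm: "\<theta> permutes {1..}" using \<theta>S by (simp add: S_inf_def)
  have pos: "p c i \<ge> 1 \<longleftrightarrow> i \<ge> 1" "q c i \<ge> 1 \<longleftrightarrow> i \<ge> 1" "\<theta> i \<ge> 1 \<longleftrightarrow> i \<ge> 1" for c i
    using permutes_in_image[OF perm(1)] permutes_in_image[OF perm(2)] permutes_in_image[OF \<theta>perm]
    by simp_all
  have inj: "p c i = p c j \<longleftrightarrow> i = j" "q c i = q c j \<longleftrightarrow> i = j" "\<theta> i = \<theta> j \<longleftrightarrow> i = j" for c i j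
    using permutes_inj[OF perm(1)] permutes_inj[OF perm(2)] permutes_inj[OF \<theta>perm]
    by (simp_all add: inj_eq)
  \<comment> \<open>Beyond \<open>M\<close> every black triangle of \<open>p\<close> and every white
    triangle of \<open>q\<close> has been deleted, so it belongs to an empty cheburek.\<close>
  have Ep: "i \<in> ?E" if "i > M" for i using that subsetD[OF Mp, of i] unfolding bA by auto
  have Fq: "i \<in> q Red ` ?F" if "i > M" for i using that subsetD[OF Mq, of i] unfolding bB by auto
  have \<theta>gt: "\<theta> w \<in> ?E" if "w \<in> white ?B" "w > \<beta>" for w
    using \<theta> Mq that by (intro Ep) (auto simp: generic_def)
  have F: "?qi (?i x) \<in> ?F" "q c (?qi (?i x)) = ?i x" if x: "x \<in> black ?A" "x > \<beta>" for x c
  proof -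
    have "?i x > M" using Mp x by (intro generic_inv[OF \<theta>]) auto
    then obtain y where y: "y \<in> ?F" "?i x = q Red y" using Fq by blast
    moreover have "?qi (q Red y) = y" by (rule permutes_inverses(2)[OF perm(2)])
    ultimately show "?qi (?i x) \<in> ?F" "q c (?qi (?i x)) = ?i x"
      using cheb_eq[of y \<beta> \<gamma> q c] by simp_all
  qed
  define \<phi> where "\<phi> = case_sum (\<lambda>x. ?qi (?i x)) (\<lambda>y. y)"
  \<comment> \<open>The color red is an arbitrary choice: by \<open>\<theta>gt\<close> the
    components of \<open>p\<close> agree at \<open>\<theta> w\<close> for the white triangles
    \<open>w\<close> of \<open>q\<close> that survive cutting. Likewise \<open>F\<close> makes red
    immaterial in \<phi>.\<close>
  define \<psi> where "\<psi> = case_sum (\<lambda>w. w) (\<lambda>w. p Red (\<theta> w))"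
  have black: "x \<in> black (glue \<beta> ?A ?B) \<Longrightarrow>
      (\<exists>a. x = Inl a \<and> a \<in> black ?A \<and> a > \<beta>) \<or> (\<exists>y. x = Inr y \<and> y \<in> black ?B)" for x
    by (auto simp: glue_def bA)
  have white: "x \<in> white (glue \<beta> ?A ?B) \<Longrightarrow>
      (\<exists>w. x = Inl w \<and> w \<in> white ?A) \<or> (\<exists>w. x = Inr w \<and> w \<in> white ?B \<and> w > \<beta>)" for x
    by (auto simp: glue_def bB)
  have "board_iso \<alpha> \<gamma> (delete_empty_chebureks \<alpha> \<gamma> (glue \<beta> ?A ?B)) (delete_empty_chebureks \<alpha> \<gamma> ?R)"
  proof (rule board_iso_delete_empty_chebureks[of _ _ _ _ \<phi> \<psi>])
    show "preboard \<alpha> \<gamma> (glue \<beta> ?A ?B)"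
      by (intro preboard_glue is_board_imp_preboard is_board_board_of p q)
    show "preboard \<alpha> \<gamma> ?R" by (rule preboard_triple[OF r])
    show "inj_on \<phi> (black (glue \<beta> ?A ?B))"
    proof (rule inj_onI)
      fix x y assume xy: "x \<in> black (glue \<beta> ?A ?B)" "y \<in> black (glue \<beta> ?A ?B)" "\<phi> x = \<phi> y"
      have "a = b" if "a \<in> black ?A" "a > \<beta>" "b \<in> black ?A" "b > \<beta>" "?qi (?i a) = ?qi (?i b)" for a b
        using F(2)[OF that(1,2), of Red] F(2)[OF that(3,4), of Red] that(5) \<theta>inv(1) by metis
      moreover have "?qi (?i a) \<noteq> b" if "a \<in> black ?A" "a > \<beta>" "b \<in> black ?B" for a b
        using F(1)[OF that(1,2)] that(3) by (auto simp: bB)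
      ultimately show "x = y" using black[OF xy(1)] black[OF xy(2)] xy(3) by (fastforce simp: \<phi>_def)
    qed
    show "inj_on \<psi> (white (glue \<beta> ?A ?B))"
    proof (rule inj_onI)
      fix x y assume xy: "x \<in> white (glue \<beta> ?A ?B)" "y \<in> white (glue \<beta> ?A ?B)" "\<psi> x = \<psi> y"
      have "p Red (\<theta> b) \<noteq> a" if "a \<in> white ?A" "b \<in> white ?B" "b > \<beta>" for a b
        using \<theta>gt[OF that(2,3)] that(1) by (auto simp: bA)
      then show "x = y" using white[OF xy(1)] white[OF xy(2)] xy(3) by (fastforce simp: \<psi>_def inj)
    qed
    show "\<phi> ` black (glue \<beta> ?A ?B) \<subseteq> black ?R"
    proof (rule image_subsetI)
      fix x assume "x \<in> black (glue \<beta> ?A ?B)"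
      then show "\<phi> x \<in> black ?R"
        using black[of x] F(1) by (fastforce simp: \<phi>_def bB cheb_def)
    qed
    show "\<psi> ` white (glue \<beta> ?A ?B) \<subseteq> white ?R"
    proof (rule image_subsetI)
      fix x assume "x \<in> white (glue \<beta> ?A ?B)"
      then show "\<psi> x \<in> white ?R"
        using white[of x] by (auto simp: \<psi>_def bA bB pos simp del: One_nat_def)
    qed
    show "adj ?R c (\<phi> x) = \<psi> (adj (glue \<beta> ?A ?B) c x)" if x: "x \<in> black (glue \<beta> ?A ?B)" for c x
      using black[OF x]
    proof (elim disjE exE conjE)
      fix a assume "x = Inl a" "a \<in> black ?A" "a > \<beta>"
      then show ?thesis using F(2) by (simp add: \<phi>_def \<psi>_def glue_def bA \<theta>inv)
    next
      fix y assume y: "x = Inr y" "y \<in> black ?B"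
      have "q c y \<in> white ?B"
        using is_board_board_of[OF q, of \<beta> \<gamma>] y(2) unfolding is_board_def bB(3)
        by (blast dest: bij_betwE)
      then show ?thesis
      proof (cases "q c y \<in> {1..\<beta>}")
        case True
        \<comment> \<open>An edge on the seam: \<theta> fixes the label \<open>q c y\<close>, so the
          product leads directly to \<open>p c (q c y)\<close>.\<close>
        then show ?thesis
          using y S_inf_fixes[OF \<theta>S, of "q c y"]
          by (simp add: \<phi>_def \<psi>_def glue_def bA bB inv_into_f_f[of id, simplified])
      next
        case False
        moreover have "q c y \<ge> 1" using \<open>q c y \<in> white ?B\<close> by (simp add: bB)
        ultimately have "\<theta> (q c y) \<in> ?E" using \<theta>gt[OF \<open>q c y \<in> white ?B\<close>] by simp
        then have "p c (\<theta> (q c y)) = p Red (\<theta> (q c y))" by (rule cheb_eq)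
        then show ?thesis using y False by (auto simp: \<phi>_def \<psi>_def glue_def bA bB)
      qed
    qed
    show "\<phi> (black_label (glue \<beta> ?A ?B) j) = black_label ?R j" if "j \<in> {1..\<gamma>}" for j
      by (simp add: \<phi>_def glue_def bB)
    show "\<psi> (white_label (glue \<beta> ?A ?B) j) = white_label ?R j" if "j \<in> {1..\<alpha>}" for j
      by (simp add: \<psi>_def glue_def bA)
    show "black ?R - \<phi> ` black (glue \<beta> ?A ?B) \<subseteq> empty_chebureks \<alpha> \<gamma> ?R"
    proof
      fix y assume y: "y \<in> black ?R - \<phi> ` black (glue \<beta> ?A ?B)"
      \<comment> \<open>A triangle outside the image of \<phi> lies in an empty cheburek of
        \<open>q\<close>, and \<theta> carries the white partner into one of \<open>p\<close>; hence
        the three components of the product agree at \<open>y\<close>.\<close>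
      have yF: "y \<in> ?F"
      proof (rule ccontr)
        assume "y \<notin> ?F"
        then have "Inr y \<in> black (glue \<beta> ?A ?B)" using y by (auto simp: glue_def bB)
        moreover have "\<phi> (Inr y) = y" by (simp add: \<phi>_def)
        ultimately show False using y by force
      qed
      then have u: "q Red y > \<beta>" "y > \<gamma>" by (simp_all add: cheb_def)
      have \<theta>u: "\<theta> (q Red y) > \<beta>" using u(1) S_inf_gt[OF \<theta>S] by simp
      have \<theta>E: "\<theta> (q Red y) \<in> ?E"
      proof (rule ccontr)
        assume "\<theta> (q Red y) \<notin> ?E"
        then have "Inl (\<theta> (q Red y)) \<in> black (glue \<beta> ?A ?B)" using \<theta>u by (auto simp: glue_def bA)
        moreover have "\<phi> (Inl (\<theta> (q Red y))) = y"
          by (simp add: \<phi>_def \<theta>inv permutes_inverses(2)[OF perm(2)])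
        ultimately show False using y by force
      qed
      then have "p Red (\<theta> (q Red y)) > \<alpha>" by (simp add: cheb_def)
      moreover have "p c (\<theta> (q c y)) = p Red (\<theta> (q Red y))" for c
        by (simp only: cheb_eq[OF yF, of c] cheb_eq[OF \<theta>E, of c])
      ultimately show "y \<in> empty_chebureks \<alpha> \<gamma> ?R"
        unfolding empty_chebureks_def using y u(2) by (auto intro!: exI[of _ "p Red (\<theta> (q Red y))"])
    qed
  qed
  then show ?thesis by (simp only: board_of_def)
qed

text \<open>By \<open>board_iso_glue\<close> all representatives in \<open>board_mult\<close> give
  the same class, so the union collapses to the class of
  \<open>board_of \<alpha> \<gamma> r\<close>, and injectivity of \<open>coset_board\<close>
  recovers the double coset.\<close>

lemma coset_mult_eq:
  assumes p: "p \<in> carrier trisym" and q: "q \<in> carrier trisym" and r: "r \<in> carrier trisym"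
    and iso: "board_iso \<alpha> \<gamma>
      (delete_empty_chebureks \<alpha> \<gamma> (glue \<beta> (board_of \<alpha> \<beta> p) (board_of \<beta> \<gamma> q))) (board_of \<alpha> \<gamma> r)"
  shows "coset_mult \<alpha> \<beta> \<gamma> (double_coset \<alpha> \<beta> p) (double_coset \<beta> \<gamma> q) = double_coset \<alpha> \<gamma> r"
proof -
  note is_p = is_board_board_of[OF p, of \<alpha> \<beta>] and is_q = is_board_board_of[OF q, of \<beta> \<gamma>]
  have "board_class \<alpha> \<gamma> (delete_empty_chebureks \<alpha> \<gamma> (glue \<beta> A B)) = board_class \<alpha> \<gamma> (board_of \<alpha> \<gamma> r)"
    if A: "A \<in> board_class \<alpha> \<beta> (board_of \<alpha> \<beta> p)" and B: "B \<in> board_class \<beta> \<gamma> (board_of \<beta> \<gamma> q)" for A B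
  proof (rule board_class_eq)
    have AB: "is_board \<alpha> \<beta> A" "is_board \<beta> \<gamma> B"
      "board_iso \<alpha> \<beta> A (board_of \<alpha> \<beta> p)" "board_iso \<beta> \<gamma> B (board_of \<beta> \<gamma> q)"
      using A B board_iso_sym[OF is_p] board_iso_sym[OF is_q] by (auto simp: board_class_def)
    show "is_board \<alpha> \<gamma> (delete_empty_chebureks \<alpha> \<gamma> (glue \<beta> A B))"
      using AB by (intro is_board_delete_empty_chebureks preboard_glue is_board_imp_preboard finite_glue)
    show "board_iso \<alpha> \<gamma> (delete_empty_chebureks \<alpha> \<gamma> (glue \<beta> A B)) (board_of \<alpha> \<gamma> r)"
      by (rule board_iso_trans[OF board_iso_glue[OF AB(1,2) is_p is_q AB(3,4)] iso])
  qed
  moreover have "board_of \<alpha> \<beta> p \<in> board_class \<alpha> \<beta> (board_of \<alpha> \<beta> p)"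
    "board_of \<beta> \<gamma> q \<in> board_class \<beta> \<gamma> (board_of \<beta> \<gamma> q)"
    using is_p is_q board_iso_refl by (auto simp: board_class_def)
  ultimately have "board_mult \<alpha> \<beta> \<gamma> (board_class \<alpha> \<beta> (board_of \<alpha> \<beta> p))
      (board_class \<beta> \<gamma> (board_of \<beta> \<gamma> q)) = board_class \<alpha> \<gamma> (board_of \<alpha> \<gamma> r)"
    unfolding board_mult_def by (intro equalityI) blast+
  then have "coset_mult \<alpha> \<beta> \<gamma> (double_coset \<alpha> \<beta> p) (double_coset \<beta> \<gamma> q) =
      inv_into (double_cosets \<alpha> \<gamma>) (coset_board \<alpha> \<gamma>) (coset_board \<alpha> \<gamma> (double_coset \<alpha> \<gamma> r))"
    by (simp only: coset_mult_def coset_board_double_coset[OF p] coset_board_double_coset[OF q]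
        coset_board_double_coset[OF r])
  also have "\<dots> = double_coset \<alpha> \<gamma> r"
    using r by (intro bij_betw_inv_into_left[OF bij_betw_coset_board]) (simp add: double_cosets_def)
  finally show ?thesis .
qed


section \<open>The representation\<close>

lemma unitary_rep_mult:
  assumes "unitary_rep \<rho>" "g \<in> carrier trisym" "h \<in> carrier trisym"
  shows "\<rho> (\<lambda>c. g c \<circ> h c) v = \<rho> g (\<rho> h v)"
proof -
  have "\<rho> (g \<otimes>\<^bsub>trisym\<^esub> h) = \<rho> g \<circ> \<rho> h"
    using assms by (auto simp: unitary_rep_def hom_def unitary_group_def)
  then show ?thesis by (simp add: fun_eq_iff)
qed

lemma unitary_rep_cinner:
  assumes "unitary_rep \<rho>" "g \<in> carrier trisym"
  shows "cinner (\<rho> g x) (\<rho> g y) = cinner x y"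
proof -
  have "\<rho> g \<in> carrier unitary_group" using assms by (auto simp: unitary_rep_def hom_def)
  then show ?thesis by (simp add: unitary_group_def)
qed

lemma unitary_rep_inner:
  "unitary_rep \<rho> \<Longrightarrow> g \<in> carrier trisym \<Longrightarrow> \<rho> g x \<bullet> \<rho> g y = x \<bullet> y"
  by (simp add: inner_eq_Re_cinner unitary_rep_cinner)

lemma unitary_rep_scaleC:
  assumes "unitary_rep \<rho>" "g \<in> carrier trisym"
  shows "\<rho> g (scaleC a x) = scaleC a (\<rho> g x)"
proof -
  have "\<rho> g \<in> carrier unitary_group" using assms by (auto simp: unitary_rep_def hom_def)
  then have "Vector_Spaces.linear scaleC scaleC (\<rho> g)" by (simp add: unitary_group_def)
  then show ?thesis by (simp add: Vector_Spaces.linear_iff)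
qed

text \<open>Multiplicativity makes the operator of the identity idempotent, and an idempotent
  isometry is the identity.\<close>

lemma unitary_rep_one:
  assumes \<rho>: "unitary_rep \<rho>"
  shows "\<rho> (\<lambda>c. id) v = v"
proof -
  have 1: "(\<lambda>c. id) \<in> carrier trisym" by (rule const_carrier[OF S_inf_id])
  have "\<rho> (\<lambda>c. id) (\<rho> (\<lambda>c. id) v) = \<rho> (\<lambda>c. id) v"
    using unitary_rep_mult[OF \<rho> 1 1, of v] by simp
  then have "(\<rho> (\<lambda>c. id) v - v) \<bullet> (\<rho> (\<lambda>c. id) v - v) = 0"
    using unitary_rep_inner[OF \<rho> 1, of v v] unitary_rep_inner[OF \<rho> 1, of "\<rho> (\<lambda>c. id) v" v]
    by (simp add: inner_diff inner_commute)
  then show ?thesis by simp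
qed

lemma inv_carrier:
  assumes "g \<in> carrier trisym"
  shows "(\<lambda>c. inv_into UNIV (g c)) \<in> carrier trisym"
    "g c (inv_into UNIV (g c) i) = i" "inv_into UNIV (g c) (g c i) = i"
proof -
  interpret group trisym by (rule group_trisym)
  have gp: "g c permutes {1..}" for c using assms by (simp add: carrier_trisym_iff)
  show 1: "g c (inv_into UNIV (g c) i) = i" "inv_into UNIV (g c) (g c i) = i" for c i
    using permutes_inverses[OF gp] by auto
  have "(inv\<^bsub>trisym\<^esub> g) c = inv_into UNIV (g c)" for c
  proof (rule ext)
    fix i
    have "(g \<otimes>\<^bsub>trisym\<^esub> inv\<^bsub>trisym\<^esub> g) c i = i" using r_inv[OF assms] by simp
    then have "g c ((inv\<^bsub>trisym\<^esub> g) c i) = i" by simp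
    then show "(inv\<^bsub>trisym\<^esub> g) c i = inv_into UNIV (g c) i" using 1 by metis
  qed
  then have "inv\<^bsub>trisym\<^esub> g = (\<lambda>c. inv_into UNIV (g c))" by (simp add: fun_eq_iff)
  then show "(\<lambda>c. inv_into UNIV (g c)) \<in> carrier trisym" using inv_closed[OF assms] by simp
qed

lemma unitary_rep_adjoint:
  assumes \<rho>: "unitary_rep \<rho>" and g: "g \<in> carrier trisym"
  shows "\<rho> g x \<bullet> y = x \<bullet> \<rho> (\<lambda>c. inv_into UNIV (g c)) y"
proof -
  have "(\<lambda>c. g c \<circ> inv_into UNIV (g c)) = (\<lambda>c. id)"
    using inv_carrier(2)[OF g] by (simp add: fun_eq_iff)
  then have "\<rho> g (\<rho> (\<lambda>c. inv_into UNIV (g c)) y) = y"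
    using unitary_rep_mult[OF \<rho> g inv_carrier(1)[OF g], of y] unitary_rep_one[OF \<rho>] by simp
  then show ?thesis
    using unitary_rep_inner[OF \<rho> g, of x "\<rho> (\<lambda>c. inv_into UNIV (g c)) y"] by simp
qed

section \<open>Fixed vectors and generic translates\<close>

lemma fixed_spaceD: "v \<in> fixed_space \<rho> \<alpha> \<Longrightarrow> s \<in> S_inf \<alpha> \<Longrightarrow> \<rho> (\<lambda>c. s) v = v"
  using mem_K by (auto simp: fixed_space_def)

lemma fixed_spaceI: "(\<And>s. s \<in> S_inf \<alpha> \<Longrightarrow> \<rho> (\<lambda>c. s) v = v) \<Longrightarrow> v \<in> fixed_space \<rho> \<alpha>"
  by (auto simp: fixed_space_def K_def)

lemma fixed_space_mono: "\<alpha> \<le> \<beta> \<Longrightarrow> fixed_space \<rho> \<alpha> \<subseteq> fixed_space \<rho> \<beta>"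
  using K_antimono by (fastforce simp: fixed_space_def)

lemma fixed_space_scaleC:
  "unitary_rep \<rho> \<Longrightarrow> v \<in> fixed_space \<rho> \<alpha> \<Longrightarrow> scaleC a v \<in> fixed_space \<rho> \<alpha>"
  using K_subset by (auto simp: fixed_space_def unitary_rep_scaleC subset_iff)

text \<open>
  The permutations \<open>q s q\<^sup>-\<^sup>1\<close> of the three colors coincide when \<open>s\<close> is supported where the components
  of \<open>q\<close> agree.
\<close>

lemma image_fixed_space:
  assumes \<rho>: "unitary_rep \<rho>" and q: "q \<in> carrier trisym"
  shows "\<exists>N. \<forall>v\<in>fixed_space \<rho> \<gamma>. \<rho> q v \<in> fixed_space \<rho> N"
proof -
  \<comment> \<open>With no white labels, \<open>?F\<close> consists of all numbers above \<gamma>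
    at which the components of \<open>q\<close> agree.\<close>
  let ?F = "cheb 0 \<gamma> q" and ?qi = "inv_into UNIV (q Red)"
  have "finite (white (board_of 0 \<gamma> q))"
    using is_board_board_of[OF q, of 0 \<gamma>] by (simp add: is_board_def)
  then obtain N where N: "white (board_of 0 \<gamma> q) \<subseteq> {..N}"
    using finite_nat_iff_bounded_le by blast
  have perm: "q c permutes {1..}" for c using q by (simp add: carrier_trisym_iff)
  note inv = inv_carrier(2,3)[OF q]
  have F: "i \<in> ?F" if "q c i > N" for c i
  proof -
    have "q c i \<in> q Red ` ?F"
      using that subsetD[OF N, of "q c i"] unfolding board_of_simps[OF q] by auto
    then obtain j where "j \<in> ?F" "q c i = q Red j" by blast
    moreover from this have "q c j = q c i" using cheb_eq by metis
    ultimately show ?thesis using inv(2) by metis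
  qed
  have "\<rho> (\<lambda>c. t) (\<rho> q v) = \<rho> q v" if v: "v \<in> fixed_space \<rho> \<gamma>" and t: "t \<in> S_inf N" for v t
  proof -
    \<comment> \<open>Off \<open>?F\<close> all values \<open>q c i\<close> are at most
      \<open>N\<close>, where \<open>t\<close> is trivial. So \<open>s\<close> preserves
      \<open>?F\<close>, where the choice of red is immaterial, and fixes everything else.\<close>
    define s where "s = ?qi \<circ> t \<circ> q Red"
    have fix_s: "s i = i" if "i \<notin> ?F" for i
    proof -
      have "q Red i \<le> N" using F that by (meson not_le)
      then show ?thesis using S_inf_fixes[OF t] by (simp add: s_def inv)
    qed
    have "s permutes {1..}"
      unfolding s_def using t perm by (intro permutes_compose permutes_inv) (auto simp: S_inf_def)
    moreover have "s i = i" if "i \<in> {1..\<gamma>}" for i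
      using that by (intro fix_s) (simp add: cheb_def)
    ultimately have s: "s \<in> S_inf \<gamma>" by (simp add: S_inf_def)
    have "t (q c i) = q c (s i)" for c i
    proof (cases "i \<in> ?F")
      case True
      have "s i \<in> ?F"
      proof (rule ccontr)
        assume "s i \<notin> ?F"
        then have "s (s i) = s i" by (rule fix_s)
        then have "s i = i" using S_inf_inverses(2)[OF s] by metis
        then show False using True \<open>s i \<notin> ?F\<close> by simp
      qed
      then have "q c (s i) = q Red (s i)" by (rule cheb_eq)
      moreover have "q c i = q Red i" using True by (rule cheb_eq)
      ultimately show ?thesis by (simp add: s_def inv)
    next
      case False
      then have "q c i \<le> N" using F by (meson not_le)
      then show ?thesis using S_inf_fixes[OF t] fix_s[OF False] by simp
    qed
    then have "(\<lambda>c. t \<circ> q c) = (\<lambda>c. q c \<circ> s)" by (simp add: fun_eq_iff)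
    then have "\<rho> (\<lambda>c. t) (\<rho> q v) = \<rho> q (\<rho> (\<lambda>c. s) v)"
      using unitary_rep_mult[OF \<rho> const_carrier[OF t] q, of v]
        unitary_rep_mult[OF \<rho> q const_carrier[OF s], of v] by simp
    then show ?thesis using fixed_spaceD[OF v s] by simp
  qed
  then show ?thesis by (auto intro!: exI[of _ N] fixed_spaceI)
qed

text \<open>In \<open>\<theta>' = s \<circ> \<theta> \<circ> t\<close> the factor \<open>t\<close>
  is absorbed by \<open>x\<close>, and \<open>s\<close> moves to \<open>y\<close> as its inverse and
  is absorbed there.\<close>

lemma inner_generic:
  assumes \<rho>: "unitary_rep \<rho>" and "\<theta> \<in> generic \<beta> M" "\<theta>' \<in> generic \<beta> M"
    and x: "x \<in> fixed_space \<rho> M" and y: "y \<in> fixed_space \<rho> M"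
  shows "\<rho> (\<lambda>c. \<theta>') x \<bullet> y = \<rho> (\<lambda>c. \<theta>) x \<bullet> y"
proof -
  obtain s t where s: "s \<in> S_inf M" and t: "t \<in> S_inf M" and eq: "\<theta>' = s \<circ> \<theta> \<circ> t"
    using generic_double_coset[OF assms(2,3)] .
  have \<theta>: "\<theta> \<in> S_inf \<beta>" using assms(2) by (simp add: generic_def)
  note car = const_carrier[OF s] const_carrier[OF t] const_carrier[OF \<theta>]
  have "\<rho> (\<lambda>c. \<theta>') x = \<rho> (\<lambda>c. s) (\<rho> (\<lambda>c. \<theta>) (\<rho> (\<lambda>c. t) x))"
    using unitary_rep_mult[OF \<rho> comp_carrier[OF car(1,3)] car(2), of x]
      unitary_rep_mult[OF \<rho> car(1,3)] by (simp add: eq)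
  then have "\<rho> (\<lambda>c. \<theta>') x = \<rho> (\<lambda>c. s) (\<rho> (\<lambda>c. \<theta>) x)" using fixed_spaceD[OF x t] by simp
  then show ?thesis
    using unitary_rep_adjoint[OF \<rho> car(1)] fixed_spaceD[OF y S_inf_inv[OF s]] by simp
qed

text \<open>The vector \<open>z\<close> is the limit of the averages of the \<open>u i\<close>. The
  first two properties identify it as the projection of \<open>x\<close>; the third lets any generic
  \<theta> stand in for that projection against vectors fixed by \<open>K M\<close>.\<close>

lemma projection_generic:
  assumes \<rho>: "unitary_rep \<rho>" and M: "\<beta> \<le> M" and x: "x \<in> fixed_space \<rho> M"
  obtains z where "z \<in> fixed_space \<rho> \<beta>" "\<And>w. w \<in> fixed_space \<rho> \<beta> \<Longrightarrow> x \<bullet> w = z \<bullet> w"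
    "\<And>\<theta> y. \<theta> \<in> generic \<beta> M \<Longrightarrow> y \<in> fixed_space \<rho> M \<Longrightarrow> z \<bullet> y = \<rho> (\<lambda>c. \<theta>) x \<bullet> y"
proof -
  define \<sigma> where "\<sigma> = block_swap \<beta> M"
  define u where "u i = \<rho> (\<lambda>c. \<sigma> i) x" for i
  define d where "d = u 0 \<bullet> x"
  have \<sigma>S: "\<sigma> i \<in> S_inf \<beta>" for i unfolding \<sigma>_def by (rule block_swap_S_inf[OF M])
  note \<sigma>car = const_carrier[OF \<sigma>S]
  have generic_d: "\<rho> (\<lambda>c. \<theta>) x \<bullet> x = d" if "\<theta> \<in> generic \<beta> M" for \<theta>
    unfolding d_def u_def \<sigma>_def by (rule inner_generic[OF \<rho> block_swap_generic[OF M] that x x])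
  have inner_u: "\<rho> (\<lambda>c. \<tau>) x \<bullet> u j = \<rho> (\<lambda>c. \<sigma> j \<circ> \<tau>) x \<bullet> x" if \<tau>: "\<tau> \<in> S_inf \<beta>" for \<tau> j
    using unitary_rep_adjoint[OF \<rho> \<sigma>car[of j], of x "\<rho> (\<lambda>c. \<tau>) x"]
      unitary_rep_mult[OF \<rho> \<sigma>car[of j] const_carrier[OF \<tau>], of x]
    by (simp add: u_def inner_commute) (simp add: \<sigma>_def inv_block_swap)
  have "u i \<bullet> u j = d" if "i \<noteq> j" for i j
    using generic_d[OF block_swap_block_swap_generic[OF M that]] inner_u[OF \<sigma>S]
    by (simp add: u_def \<sigma>_def)
  moreover have "u i \<bullet> u i = x \<bullet> x" for i
    unfolding u_def by (rule unitary_rep_inner[OF \<rho> \<sigma>car])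
  ultimately obtain z where z: "\<And>w c. eventually (\<lambda>j. u j \<bullet> w = c) sequentially \<Longrightarrow> z \<bullet> w = c"
    using exists_mean[of u d "x \<bullet> x"] by blast
  \<comment> \<open>For large \<open>j\<close> the product \<open>\<sigma> j \<circ> \<tau>\<close>
    is generic. Thus \<open>z\<close> has the same inner product with the whole orbit of
    \<open>x\<close> under \<open>S_inf \<beta>\<close>, which forces its invariance below.\<close>
  have z_orbit: "z \<bullet> \<rho> (\<lambda>c. \<tau>) x = d" if "\<tau> \<in> S_inf \<beta>" for \<tau>
    using eventually_block_swap_generic[OF M that] generic_d inner_u[OF that]
    by (intro z) (auto elim!: eventually_mono simp: inner_commute \<sigma>_def)
  show thesis
  proof (rule that)
    show "z \<in> fixed_space \<rho> \<beta>"
    proof (rule fixed_spaceI)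
      fix s assume s: "s \<in> S_inf \<beta>"
      note car = const_carrier[OF s]
      let ?s' = "inv_into UNIV s"
      have "u j \<bullet> \<rho> (\<lambda>c. s) z = d" for j
      proof -
        have "u j \<bullet> \<rho> (\<lambda>c. s) z = z \<bullet> \<rho> (\<lambda>c. ?s') (u j)"
          using unitary_rep_adjoint[OF \<rho> car, of z "u j"] by (simp add: inner_commute)
        also have "\<dots> = z \<bullet> \<rho> (\<lambda>c. ?s' \<circ> \<sigma> j) x"
          using unitary_rep_mult[OF \<rho> const_carrier[OF S_inf_inv[OF s]] \<sigma>car] by (simp add: u_def)
        also have "\<dots> = d" by (intro z_orbit S_inf_compose S_inf_inv s \<sigma>S)
        finally show ?thesis .
      qed
      then have 1: "z \<bullet> \<rho> (\<lambda>c. s) z = d" by (intro z) simp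
      have "u j \<bullet> z = d" for j using z_orbit[OF \<sigma>S] by (simp add: u_def inner_commute)
      then have 2: "z \<bullet> z = d" by (intro z) simp
      \<comment> \<open>Expanding gives \<open>d - 2 * d + d\<close>.\<close>
      have "(\<rho> (\<lambda>c. s) z - z) \<bullet> (\<rho> (\<lambda>c. s) z - z) = 0"
        using 1 2 unitary_rep_inner[OF \<rho> car, of z z] by (simp add: inner_diff inner_commute)
      then show "\<rho> (\<lambda>c. s) z = z" by simp
    qed
    show "x \<bullet> w = z \<bullet> w" if "w \<in> fixed_space \<rho> \<beta>" for w
    proof -
      have "u j \<bullet> w = x \<bullet> w" for j
        using unitary_rep_inner[OF \<rho> \<sigma>car[of j], of x w] fixed_spaceD[OF that \<sigma>S] by (simp add: u_def)
      then show ?thesis using z[of w "x \<bullet> w"] by simp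
    qed
    show "z \<bullet> y = \<rho> (\<lambda>c. \<theta>) x \<bullet> y" if "\<theta> \<in> generic \<beta> M" "y \<in> fixed_space \<rho> M" for \<theta> y
    proof -
      have "u j \<bullet> y = \<rho> (\<lambda>c. \<theta>) x \<bullet> y" for j
        unfolding u_def \<sigma>_def by (rule inner_generic[OF \<rho> that(1) block_swap_generic[OF M] x that(2)])
      then show ?thesis by (intro z) simp
    qed
  qed
qed

section \<open>Orthogonal projections from real inner products\<close>

lemma cinner_eq_if_inner_eq:
  fixes x y :: "'h::complex_hilbert"
  assumes "x \<bullet> w = y \<bullet> w" "x \<bullet> scaleC \<i> w = y \<bullet> scaleC \<i> w"
  shows "cinner x w = cinner y w"
proof -
  have "cinner v (scaleC \<i> w) = - \<i> * cinner v w" for v :: 'h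
    using cinner_commute[of v "scaleC \<i> w"] cinner_scaleC_left[of \<i> w v] cinner_commute[of v w]
    by simp
  then show ?thesis using assms by (simp add: inner_eq_Re_cinner complex_eq_iff)
qed

lemma cinner_diff_left: "cinner (x - y) z = cinner x z - cinner y z"
  using cinner_add_left[of "x - y" y z] by simp

text \<open>The fixed space is closed under multiplication by \<open>\<i>\<close>, and pairing with
  \<open>scaleC \<i> w\<close> recovers the imaginary part. This is why the averaging argument can
  be carried out with real inner products.\<close>

lemma cinner_eq_on_fixed_space:
  assumes "unitary_rep \<rho>" "\<And>w. w \<in> fixed_space \<rho> \<alpha> \<Longrightarrow> x \<bullet> w = y \<bullet> w" "w \<in> fixed_space \<rho> \<alpha>"
  shows "cinner x w = cinner y w"
  using assms fixed_space_scaleC by (intro cinner_eq_if_inner_eq) blast+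

text \<open>The description inside \<open>THE\<close> sees a vector only through its products with
  fixed vectors, so the equality holds before any projection has been shown to exist.\<close>

lemma orth_proj_fixed_space_cong:
  assumes "unitary_rep \<rho>" "\<And>w. w \<in> fixed_space \<rho> \<alpha> \<Longrightarrow> x \<bullet> w = y \<bullet> w"
  shows "orth_proj (fixed_space \<rho> \<alpha>) x = orth_proj (fixed_space \<rho> \<alpha>) y"
  using cinner_eq_on_fixed_space[OF assms] by (simp add: orth_proj_def cinner_diff_left)

lemma unitary_rep_diff:
  assumes "unitary_rep \<rho>" "g \<in> carrier trisym"
  shows "\<rho> g (x - y) = \<rho> g x - \<rho> g y"
proof -
  have "\<rho> g \<in> carrier unitary_group" using assms by (auto simp: unitary_rep_def hom_def)
  then have "Vector_Spaces.linear scaleC scaleC (\<rho> g)" by (simp add: unitary_group_def)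
  then show ?thesis by (rule module_hom.diff[OF Vector_Spaces.linear.axioms(3)])
qed

text \<open>Uniqueness holds because the difference of two candidates lies in the fixed space and is
  orthogonal to itself.\<close>

lemma orth_proj_fixed_space_eq:
  assumes \<rho>: "unitary_rep \<rho>" and z: "z \<in> fixed_space \<rho> \<alpha>"
    and "\<And>w. w \<in> fixed_space \<rho> \<alpha> \<Longrightarrow> x \<bullet> w = z \<bullet> w"
  shows "orth_proj (fixed_space \<rho> \<alpha>) x = z"
proof -
  have xz: "cinner x w = cinner z w" if "w \<in> fixed_space \<rho> \<alpha>" for w
    using assms that by (intro cinner_eq_on_fixed_space[OF \<rho>]) auto
  show ?thesis unfolding orth_proj_def
  proof (rule the_equality)
    show "z \<in> fixed_space \<rho> \<alpha> \<and> (\<forall>w\<in>fixed_space \<rho> \<alpha>. cinner (x - z) w = 0)"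
      using z xz by (simp add: cinner_diff_left)
    fix y assume y: "y \<in> fixed_space \<rho> \<alpha> \<and> (\<forall>w\<in>fixed_space \<rho> \<alpha>. cinner (x - y) w = 0)"
    then have "z - y \<in> fixed_space \<rho> \<alpha>"
      using z K_subset by (auto simp: fixed_space_def unitary_rep_diff[OF \<rho>] subset_iff)
    then have "cinner (z - y) (z - y) = 0"
      using y xz[of "z - y"] by (simp add: cinner_diff_left)
    then have "(z - y) \<bullet> (z - y) = 0" by (simp add: inner_eq_Re_cinner)
    then show "y = z" by simp
  qed
qed

theorem theorem3p1:
  fixes \<rho> :: "(color \<Rightarrow> nat \<Rightarrow> nat) \<Rightarrow> 'h::complex_hilbert \<Rightarrow> 'h"
    and \<alpha> \<beta> \<gamma> :: nat
    and \<aa> \<bb> :: "(color \<Rightarrow> nat \<Rightarrow> nat) set"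
  assumes "unitary_rep \<rho>"
    and "\<aa> \<in> double_cosets \<alpha> \<beta>"
    and "\<bb> \<in> double_cosets \<beta> \<gamma>"
  shows "compose (fixed_space \<rho> \<gamma>) (rho_bar \<rho> \<alpha> \<beta> \<aa>) (rho_bar \<rho> \<beta> \<gamma> \<bb>)
       = rho_bar \<rho> \<alpha> \<gamma> (coset_mult \<alpha> \<beta> \<gamma> \<aa> \<bb>)"
proof -
  note \<rho> = assms(1)
  obtain p q where p: "p \<in> carrier trisym" and a: "\<aa> = double_coset \<alpha> \<beta> p"
    and q: "q \<in> carrier trisym" and b: "\<bb> = double_coset \<beta> \<gamma> q"
    using assms by (auto simp: double_cosets_def)
  let ?p' = "\<lambda>c. inv_into UNIV (p c)"
  obtain N where N: "\<And>v. v \<in> fixed_space \<rho> \<gamma> \<Longrightarrow> \<rho> q v \<in> fixed_space \<rho> N"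
    using image_fixed_space[OF \<rho> q] by blast
  obtain N' where N': "\<And>w. w \<in> fixed_space \<rho> \<alpha> \<Longrightarrow> \<rho> ?p' w \<in> fixed_space \<rho> N'"
    using image_fixed_space[OF \<rho> inv_carrier(1)[OF p]] by blast
  have "finite (black (board_of \<alpha> \<beta> p) \<union> white (board_of \<beta> \<gamma> q))"
    using is_board_board_of[OF p, of \<alpha> \<beta>] is_board_board_of[OF q, of \<beta> \<gamma>] by (simp add: is_board_def)
  then obtain L where L: "black (board_of \<alpha> \<beta> p) \<union> white (board_of \<beta> \<gamma> q) \<subseteq> {..L}"
    using finite_nat_iff_bounded_le by blast
  \<comment> \<open>Large enough for \<theta> to separate the two boards (\<open>L\<close>) and for
    the vectors on both sides of the inner product to be fixed by \<open>K M\<close>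
    (\<open>N\<close> and \<open>N'\<close>).\<close>
  define M where "M = Max {\<beta>, N, N', L}"
  have M: "\<beta> \<le> M" "N \<le> M" "N' \<le> M" "L \<le> M" by (simp_all add: M_def)
  define \<theta> where "\<theta> = block_swap \<beta> M 0"
  have \<theta>: "\<theta> \<in> generic \<beta> M" unfolding \<theta>_def by (rule block_swap_generic[OF M(1)])
  then have "\<theta> \<in> S_inf \<beta>" by (simp add: generic_def)
  note \<theta>car = const_carrier[OF this]
  define r where "r = (\<lambda>c. p c \<circ> \<theta> \<circ> q c)"
  have r: "r \<in> carrier trisym"
    using comp_carrier[OF comp_carrier[OF p \<theta>car] q] by (simp add: r_def)
  have \<rho>r: "\<rho> r v = \<rho> p (\<rho> (\<lambda>c. \<theta>) (\<rho> q v))" for v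
    using unitary_rep_mult[OF \<rho> comp_carrier[OF p \<theta>car] q, of v] unitary_rep_mult[OF \<rho> p \<theta>car]
    by (simp add: r_def)
  have "coset_mult \<alpha> \<beta> \<gamma> \<aa> \<bb> = double_coset \<alpha> \<gamma> r"
    unfolding a b using L M(4)
    by (intro coset_mult_eq p q r, unfold r_def) (intro board_iso_generic[OF p q \<theta>], auto)
  then have "rho_bar \<rho> \<alpha> \<gamma> (coset_mult \<alpha> \<beta> \<gamma> \<aa> \<bb>) = rho_bar_elem \<rho> \<alpha> \<gamma> r"
    by (simp add: rho_bar_double_coset[OF \<rho> r])
  moreover have "rho_bar_elem \<rho> \<alpha> \<beta> p (rho_bar_elem \<rho> \<beta> \<gamma> q v) = rho_bar_elem \<rho> \<alpha> \<gamma> r v"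
    if v: "v \<in> fixed_space \<rho> \<gamma>" for v
  proof -
    have x: "\<rho> q v \<in> fixed_space \<rho> M" using N[OF v] fixed_space_mono[OF M(2)] by blast
    obtain z where z: "z \<in> fixed_space \<rho> \<beta>" "\<And>w. w \<in> fixed_space \<rho> \<beta> \<Longrightarrow> \<rho> q v \<bullet> w = z \<bullet> w"
      "\<And>\<theta> y. \<theta> \<in> generic \<beta> M \<Longrightarrow> y \<in> fixed_space \<rho> M \<Longrightarrow> z \<bullet> y = \<rho> (\<lambda>c. \<theta>) (\<rho> q v) \<bullet> y"
      using projection_generic[OF \<rho> M(1) x] by blast
    have "orth_proj (fixed_space \<rho> \<beta>) (\<rho> q v) = z"
      by (rule orth_proj_fixed_space_eq[OF \<rho> z(1,2)])
    moreover have "orth_proj (fixed_space \<rho> \<alpha>) (\<rho> p z) = orth_proj (fixed_space \<rho> \<alpha>) (\<rho> r v)"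
    proof (rule orth_proj_fixed_space_cong[OF \<rho>])
      fix w assume "w \<in> fixed_space \<rho> \<alpha>"
      then have y: "\<rho> ?p' w \<in> fixed_space \<rho> M" using N' fixed_space_mono[OF M(3)] by blast
      \<comment> \<open>Moving \<open>\<rho> p\<close> to the other side turns \<open>w\<close> into
        a vector fixed by \<open>K M\<close>, against which \<open>z\<close> and the translate by
        \<theta> agree.\<close>
      show "\<rho> p z \<bullet> w = \<rho> r v \<bullet> w"
        using z(3)[OF \<theta> y] by (simp add: \<rho>r unitary_rep_adjoint[OF \<rho> p])
    qed
    ultimately show ?thesis using v z(1) by (simp add: rho_bar_elem_def)
  qed
  \<comment> \<open>Outside \<open>fixed_space \<rho> \<gamma>\<close> both sides are
    \<open>undefined\<close>, by the restrictions in \<open>compose\<close> and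
    \<open>rho_bar_elem\<close>.\<close>
  ultimately show ?thesis
    unfolding a b
    by (simp add: rho_bar_double_coset[OF \<rho>] p q compose_def fun_eq_iff)
      (simp add: rho_bar_elem_def)
qed

end
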